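(* Consider a family, indexed by the number of arms $N\ge 1$, of contextual restless bandit systems with finite state space $\mathcal{S}$, action space $\mathcal{A}=\{0,1\}$, finite global context space $\mathcal{G}$, global context transition kernel $G$, discount factor $\beta\in(0,1)$ and budgets $C_g$ ($g\in\mathcal{G}$), as described in the context. Assume: (A1) all arms share the same transition kernel and reward function: $P_i(\cdot)\equiv P(\cdot)$ and $R_i(\cdot)\equiv R(\cdot)$ for all $i\in[N]$; (A2) $P(s'|g,s,a)$ is a rational number for all $s'\in\mathcal{S}$, $g\in\mathcal{G}$, $s\in\mathcal{S}$, $a\in\mathcal{A}$; (A3) the global context is periodic: there exists an integer $T\geq 1$ such that $g_{t+T}=g_t$ for all times $t$; (A4) the budget scales linearly with $N$: $C_g=\alpha_g N$ with a fixed $\alpha_g$ (not depending on $N$), for all $g\in\mathcal{G}$. Let $\pi^*_{\mathrm{Rel}}$ be an optimal policy of the Relaxed problem with $N=1$, and let $m^*_g$ ($g\in\mathcal{G}$) be the associated steady-state distributions, $m^*_g(s)=\lim_{t\to\infty}\mathbb{P}(s_{i,t}=s\mid g_t=g,\pi^*_{\mathrm{Rel}})$. Suppose that the initial global context $g_0$ is chosen uniformly at random from $\mathcal{G}$ and that, given $g_0$, the initial states $s_{i,0}$ of the arms $i\in[N]$ are chosen independently with distribution $\mathbb{P}(s_{i,0}=s\mid g_0=g)=m^*_g(s)$. Let $V^N_{\mathrm{Pri}}$ and $V^N_{\mathrm{Rel}}$ be the optimal objective values of the Primal and the Relaxed problem with $N$ arms under this initial distribution. Then $$V^N_{\mathrm{Rel}}\;\ge\;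 V^N_{\mathrm{Pri}}\;\ge\; V^N_{\mathrm{Rel}}-\mathcal{O}(\sqrt{N}),$$ where $\mathcal{O}(\sqrt N)$ refers to $N\to\infty$ with all other data ($\mathcal{S},\mathcal{G},G,P,R,\beta,(\alpha_g)_{g\in\mathcal{G}}$) fixed.
   Context: **Contextual restless bandit (CRB) system.** $[N]:=\{1,\dots,N\}$ is the set of arms and time is $t=0,1,2,\dots$. The spaces $\mathcal{S}$ (arm states) and $\mathcal{G}$ (global contexts) are finite and $\mathcal{A}=\{0,1\}$; they are shared by all arms. The global context $(g_t)_{t\ge0}$ is a positive-recurrent Markov process on $\mathcal{G}$ with transition kernel $G(g'|g)=\mathbb{P}(g_{t+1}=g'\mid g_t=g)$, evolving independently of the states and actions of the arms. Arm $i$ has a reward function $R_i:\mathcal{G}\times\mathcal{S}\times\mathcal{A}\to\mathbb{R}$ and a transition kernel $P_i(s'|g,s,a)=\mathbb{P}(s_{i,t+1}=s'\mid g_t=g,s_{i,t}=s,a_{i,t}=a)$. At each time $t$ the decision-maker observes $g_t$ and all states $\boldsymbol{s}_t=(s_{1,t},\dots,s_{N,t})$ and chooses actions $\boldsymbol{a}_t=(a_{1,t},\dots,a_{N,t})\in\{0,1\}^N$ according to a (possibly randomized) policy $\pi(\boldsymbol{a}\mid\boldsymbol{s},g)$. Every arm then yields reward $r_{i,t}=R_i(g_t,s_{i,t},a_{i,t})$ and moves to $s_{i,t+1}\sim P_i(\cdot|g_t,s_{i,t},a_{i,t})$; given $g_t$, $\boldsymbol s_t$ and $\boldsymbol a_t$,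 the arms' transitions and the context transition are mutually independent. $C_g$ is the budget when the global context is $g$. **Primal problem with $N$ arms.** Maximize over policies $\pi$ the value $\mathbb{E}_\pi\big[\sum_{t=0}^\infty\sum_{i=1}^N\beta^t r_{i,t}\big]$ subject to $\sum_{i=1}^N a_{i,t}\le C_{g_t}$ for all $t\ge 0$. **Relaxed problem with $N$ arms.** Maximize over policies $\pi$ the same objective $\mathbb{E}_\pi\big[\sum_{t=0}^\infty\sum_{i=1}^N\beta^t r_{i,t}\big]$ subject to, for every $g\in\mathcal{G}$, $$\mathbb{E}_\pi\Big[\sum_{t=0}^\infty\beta^t\,\mathbb{I}(g_t=g)\sum_{i=1}^N a_{i,t}\Big]\le \mathbb{E}_\pi\Big[\sum_{t=0}^\infty\beta^t\,\mathbb{I}(g_t=g)\Big]\,C_g .$$ For $N=1$ the budget in the Relaxed problem is $C_g=\alpha_g$. **Conventions.** All expectations in both problems are taken with respect to the initial distribution specified in the claim (in particular, $\pi^*_{\mathrm{Rel}}$ is optimal for the one-arm Relaxed problem with that initial distribution). The limit defining $m^*_g(s)$ is over times $t$ at which $g_t=g$, for an arm controlled by $\pi^*_{\mathrm{Rel}}$, and is taken to exist. *)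

theory Defs
  imports "HOL-Probability.Probability"
begin

section \<open>Markov chains\<close>

text \<open>The law on trajectories of the Markov chain with initial distribution \<open>\<nu>\<close> and kernel \<open>K\<close>, given
  by the Ionescu-Tulcea theorem. The lemma \<open>chain_path\<close> below characterises it.\<close>

definition chain_step :: "'x pmf \<Rightarrow> ('x \<Rightarrow> 'x pmf) \<Rightarrow> nat \<Rightarrow> (nat \<Rightarrow> 'x) \<Rightarrow> 'x measure" where
  "chain_step \<nu> K t \<omega> = measure_pmf (if t = 0 then \<nu> else K (\<omega> (t - 1)))"

definition chain :: "'x pmf \<Rightarrow> ('x \<Rightarrow> 'x pmf) \<Rightarrow> (nat \<Rightarrow> 'x) measure" where
  "chain \<nu> K = projective_family.lim UNIV
     (Ionescu_Tulcea.CI (chain_step \<nu> K) (\<lambda>_. count_space UNIV)) (\<lambda>_. count_space UNIV)"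

lemma chain_Ionescu_Tulcea: "Ionescu_Tulcea (chain_step \<nu> K) (\<lambda>_. count_space UNIV)"
proof (rule Ionescu_Tulcea.intro)
  fix i
  show "chain_step \<nu> K i \<in>
      PiM {0..<i} (\<lambda>_. count_space UNIV) \<rightarrow>\<^sub>M subprob_algebra (count_space UNIV)"
  proof (cases i)
    case 0
    then show ?thesis by (simp add: chain_step_def [abs_def] measurable_const measure_pmf_in_subprob_algebra)
  next
    case (Suc j)
    have "(\<lambda>\<omega>. \<omega> j) \<in> PiM {0..<i} (\<lambda>_. count_space UNIV) \<rightarrow>\<^sub>M (count_space UNIV :: 'a measure)"
      using Suc by (intro measurable_component_singleton) auto
    moreover have "(\<lambda>x. measure_pmf (K x)) \<in> count_space UNIV \<rightarrow>\<^sub>M subprob_algebra (count_space UNIV)"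
      by (auto simp: measure_pmf_in_subprob_algebra)
    ultimately have "(\<lambda>\<omega>. measure_pmf (K (\<omega> j))) \<in>
        PiM {0..<i} (\<lambda>_. count_space UNIV) \<rightarrow>\<^sub>M subprob_algebra (count_space UNIV)"
      by (rule measurable_compose)
    with Suc show ?thesis by (simp add: chain_step_def [abs_def])
  qed
next
  fix i :: nat and x :: "nat \<Rightarrow> 'a"
  show "prob_space (chain_step \<nu> K i x)"
    unfolding chain_step_def by (rule measure_pmf.prob_space_axioms)
qed

lemma sets_chain: "sets (chain \<nu> K) = sets (PiM UNIV (\<lambda>_. count_space UNIV))"
proof -
  interpret Ionescu_Tulcea "chain_step \<nu> K" "\<lambda>_. count_space UNIV"
    by (rule chain_Ionescu_Tulcea)
  show ?thesis by (simp add: chain_def)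
qed

lemma space_chain [simp]: "space (chain \<nu> K) = UNIV"
  using sets_eq_imp_space_eq [OF sets_chain [of \<nu> K]] by (simp add: space_PiM)

lemma measurable_chain_component: "(\<lambda>\<omega>. \<omega> t) \<in> chain \<nu> K \<rightarrow>\<^sub>M count_space UNIV"
  unfolding measurable_cong_sets [OF sets_chain refl] by (rule measurable_component_singleton) simp

lemma emeasure_chain_path:
  "emeasure (chain \<nu> K) {\<omega>. \<forall>t\<le>n. \<omega> t = x t} =
     ennreal (pmf \<nu> (x 0) * (\<Prod>t<n. pmf (K (x t)) (x (Suc t))))"
proof -
  let ?M = "\<lambda>_::nat. count_space (UNIV :: 'a set)"
  interpret IT: Ionescu_Tulcea "chain_step \<nu> K" ?M
    by (rule chain_Ionescu_Tulcea)
  let ?k = "\<lambda>t. if t = 0 then pmf \<nu> (x 0) else pmf (K (x (t - 1))) (x t)"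
  let ?p = "\<lambda>n. restrict x {0..<n}"
  have sing: "{?p n} \<in> sets (PiM {0..<n} ?M)" for n
  proof -
    have "PiE {0..<n} (\<lambda>t. {x t}) = {?p n}"
      by (simp add: PiE_eq_singleton)
    moreover have "PiE {0..<n} (\<lambda>t. {x t}) \<in> sets (PiM {0..<n} ?M)"
      by (rule sets_PiM_I_finite) auto
    ultimately show ?thesis by simp
  qed
  have C: "emeasure (IT.C 0 n (\<lambda>_. undefined)) {?p n} = (\<Prod>t<n. ennreal (?k t))" for n
  proof (induction n)
    case 0
    have "?p 0 = (\<lambda>_. undefined)" by auto
    then show ?case using sing [of 0] by simp
  next
    case (Suc n)
    have u: "(\<lambda>_. undefined) \<in> space (PiM {0..<0::nat} ?M)" by (simp add: space_PiM)
    have sp: "space (IT.C 0 n (\<lambda>_. undefined)) = space (PiM {0..<n} ?M)"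
      using IT.space_C [OF u, of n] by simp
    have eP: "emeasure (IT.eP n \<omega>) {?p (Suc n)} = ennreal (?k n) * indicator {?p n} \<omega>"
      if "\<omega> \<in> space (PiM {0..<n} ?M)" for \<omega>
    proof -
      have ext: "\<omega> \<in> extensional {0..<n}" using that by (simp add: space_PiM PiE_iff)
      have eq: "fun_upd \<omega> n y = ?p (Suc n) \<longleftrightarrow> \<omega> = ?p n \<and> y = x n" for y
      proof
        assume *: "fun_upd \<omega> n y = ?p (Suc n)"
        have "\<omega> t = ?p n t" for t
          using fun_cong [OF *, of t] ext by (cases "t < n") (auto simp: extensional_def)
        then have "\<omega> = ?p n" by (rule HOL.ext)
        moreover have "y = x n" using fun_cong [OF *, of n] by simp
        ultimately show "\<omega> = ?p n \<and> y = x n" ..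
      next
        assume "\<omega> = ?p n \<and> y = x n"
        then show "fun_upd \<omega> n y = ?p (Suc n)" by (simp add: fun_eq_iff restrict_def)
      qed
      have pre: "(\<lambda>y. fun_upd \<omega> n y) -` {?p (Suc n)} = {y. \<omega> = ?p n \<and> y = x n}"
        by (simp only: vimage_def singleton_iff eq)
      have "emeasure (IT.eP n \<omega>) {?p (Suc n)} = emeasure (chain_step \<nu> K n \<omega>) {y. \<omega> = ?p n \<and> y = x n}"
        using IT.emeasure_eP [OF that sing [of "Suc n"]] unfolding pre by simp
      also have "\<dots> = ennreal (?k n) * indicator {?p n} \<omega>"
      proof (cases "\<omega> = ?p n")
        case True
        then have "chain_step \<nu> K n \<omega> = measure_pmf (if n = 0 then \<nu> else K (x (n - 1)))"
          by (simp add: chain_step_def)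
        with True show ?thesis by (simp add: emeasure_pmf_single)
      qed simp
      finally show ?thesis .
    qed
    have ne: "space (IT.C 0 n (\<lambda>_. undefined)) \<noteq> {}"
      by (simp add: sp space_PiM PiE_eq_empty_iff)
    have sets_C: "sets (IT.C 0 n (\<lambda>_. undefined)) = sets (PiM {0..<n} ?M)"
      using IT.sets_C [OF u, of n] by simp
    have meas: "IT.eP n \<in> IT.C 0 n (\<lambda>_. undefined) \<rightarrow>\<^sub>M subprob_algebra (PiM {0..<Suc n} ?M)"
      unfolding measurable_cong_sets [OF sets_C refl] by (rule IT.measurable_eP)
    have "emeasure (IT.C 0 (Suc n) (\<lambda>_. undefined)) {?p (Suc n)} =
        (\<integral>\<^sup>+\<omega>. emeasure (IT.eP n \<omega>) {?p (Suc n)} \<partial>IT.C 0 n (\<lambda>_. undefined))"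
      using emeasure_bind [OF ne meas sing] by simp
    also have "\<dots> = (\<integral>\<^sup>+\<omega>. ennreal (?k n) * indicator {?p n} \<omega> \<partial>IT.C 0 n (\<lambda>_. undefined))"
      by (intro nn_integral_cong eP) (simp add: sp)
    also have "\<dots> = ennreal (?k n) * emeasure (IT.C 0 n (\<lambda>_. undefined)) {?p n}"
      using sing [of n] by (intro nn_integral_cmult_indicator) (simp add: sets_C)
    finally have "emeasure (IT.C 0 (Suc n) (\<lambda>_. undefined)) {?p (Suc n)} =
        ennreal (?k n) * (\<Prod>t<n. ennreal (?k t))"
      unfolding Suc .
    then show ?case by (simp only: prod.lessThan_Suc mult.commute)
  qed
  have "{\<omega>. \<forall>t\<le>n. \<omega> t = x t} = IT.PF.emb UNIV {0..<Suc n} {?p (Suc n)}"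
  proof -
    have "restrict \<omega> {0..<Suc n} = ?p (Suc n) \<longleftrightarrow> (\<forall>t\<le>n. \<omega> t = x t)" for \<omega>
      unfolding fun_eq_iff restrict_def by (metis atLeast0LessThan lessThan_iff less_Suc_eq_le)
    then show ?thesis by (simp add: prod_emb_def space_PiM vimage_def)
  qed
  then have "emeasure (chain \<nu> K) {\<omega>. \<forall>t\<le>n. \<omega> t = x t} = emeasure (IT.CI {0..<Suc n}) {?p (Suc n)}"
    unfolding chain_def using IT.lim [OF _ sing [of "Suc n"]] by simp
  also have "\<dots> = emeasure (IT.C 0 (Suc n) (\<lambda>_. undefined)) {?p (Suc n)}"
    using IT.emeasure_CI [of "{0..<Suc n}" "Suc n", OF _ sing [of "Suc n"]] sets.sets_into_space [OF sing [of "Suc n"]]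
    by (simp add: prod_emb_id space_PiM)
  also have "\<dots> = (\<Prod>t<Suc n. ennreal (?k t))" by (rule C)
  also have "\<dots> = ennreal (\<Prod>t<Suc n. ?k t)" by (rule prod_ennreal) auto
  also have "(\<Prod>t<Suc n. ?k t) = pmf \<nu> (x 0) * (\<Prod>t<n. pmf (K (x t)) (x (Suc t)))"
    by (simp add: prod.lessThan_Suc_shift del: prod.lessThan_Suc)
  finally show ?thesis .
qed

lemma prob_space_chain: "prob_space (chain \<nu> K)"
proof -
  interpret IT: Ionescu_Tulcea "chain_step \<nu> K" "\<lambda>_. count_space UNIV"
    by (rule chain_Ionescu_Tulcea)
  have "emeasure IT.PF.lim (IT.PF.emb UNIV {} {\<lambda>_. undefined}) = emeasure (IT.CI {}) {\<lambda>_. undefined}"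
    by (rule IT.lim) (auto simp: PiM_empty)
  also have "\<dots> = 1"
    using prob_space.emeasure_space_1 [OF IT.PF.prob_space_P [of "{}"]]
    by (simp add: IT.PF.space_P space_PiM)
  finally have "emeasure (chain \<nu> K) UNIV = 1"
    by (simp add: chain_def prod_emb_def space_PiM restrict_def)
  then show ?thesis by (intro prob_spaceI) simp
qed

lemma chain_path:
  "measure (chain \<nu> K) {\<omega>. \<forall>t\<le>n. \<omega> t = x t} =
     pmf \<nu> (x 0) * (\<Prod>t<n. pmf (K (x t)) (x (Suc t)))"
  by (simp add: measure_def emeasure_chain_path prod_nonneg)

definition return_time :: "'x \<Rightarrow> (nat \<Rightarrow> 'x) \<Rightarrow> ennreal" where
  "return_time x \<omega> = (INF t\<in>{t. 1 \<le> t \<and> \<omega> t = x}. of_nat t)"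

definition positive_recurrent :: "('x \<Rightarrow> 'x pmf) \<Rightarrow> bool" where
  "positive_recurrent K \<longleftrightarrow> (\<forall>x. (\<integral>\<^sup>+\<omega>. return_time x \<omega> \<partial>chain (return_pmf x) K) < \<infinity>)"


section \<open>Contextual restless bandits\<close>

text \<open>The actions 0 and 1 are rendered as \<^term>\<open>False\<close> and \<^term>\<open>True\<close>. The arms are numbered from 1;
  only the arms in \<open>{1..narms sys}\<close> are part of the system.\<close>

record ('g, 's) crb =
  narms :: nat
  ctx_kernel :: "'g \<Rightarrow> 'g pmf"
  arm_kernel :: "nat \<Rightarrow> 'g \<Rightarrow> 's \<Rightarrow> bool \<Rightarrow> 's pmf"
  reward :: "nat \<Rightarrow> 'g \<Rightarrow> 's \<Rightarrow> bool \<Rightarrow> real"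
  discount :: real
  budget :: "'g \<Rightarrow> real"

type_synonym ('g, 's) policy = "(nat \<Rightarrow> 's) \<Rightarrow> 'g \<Rightarrow> (nat \<Rightarrow> bool) pmf"

text \<open>What happens at one time: the global context, the states of the arms and their actions.\<close>

type_synonym ('g, 's) snapshot = "'g \<times> (nat \<Rightarrow> 's) \<times> (nat \<Rightarrow> bool)"

abbreviation ctx_of :: "('g, 's) snapshot \<Rightarrow> 'g" where "ctx_of x \<equiv> fst x"
abbreviation states_of :: "('g, 's) snapshot \<Rightarrow> nat \<Rightarrow> 's" where "states_of x \<equiv> fst (snd x)"
abbreviation actions_of :: "('g, 's) snapshot \<Rightarrow> nat \<Rightarrow> bool" where "actions_of x \<equiv> snd (snd x)"

text \<open>Joint states and joint actions are functions on \<open>{1..narms sys}\<close>, extended by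
  \<^term>\<open>undefined\<close>; this is also the default value used below in \<^const>\<open>Pi_pmf\<close>.\<close>

definition policies :: "('g, 's) crb \<Rightarrow> ('g, 's) policy set" where
  "policies sys = {\<pi>. \<forall>s \<in> {1..narms sys} \<rightarrow>\<^sub>E UNIV. \<forall>g. set_pmf (\<pi> s g) \<subseteq> {1..narms sys} \<rightarrow>\<^sub>E UNIV}"

definition crb_init ::
  "('g \<times> (nat \<Rightarrow> 's)) pmf \<Rightarrow> ('g, 's) policy \<Rightarrow> ('g, 's) snapshot pmf" where
  "crb_init \<iota> \<pi> = do {
     (g, s) \<leftarrow> \<iota>;
     a \<leftarrow> \<pi> s g;
     return_pmf (g, s, a)
   }"

definition crb_step ::
  "('g, 's) crb \<Rightarrow> ('g, 's) policy \<Rightarrow> ('g, 's) snapshot \<Rightarrow> ('g, 's) snapshot pmf" where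
  "crb_step sys \<pi> = (\<lambda>(g, s, a). do {
     g' \<leftarrow> ctx_kernel sys g;
     s' \<leftarrow> Pi_pmf {1..narms sys} undefined (\<lambda>i. arm_kernel sys i g (s i) (a i));
     a' \<leftarrow> \<pi> s' g';
     return_pmf (g', s', a')
   })"

definition crb_process ::
  "('g, 's) crb \<Rightarrow> ('g \<times> (nat \<Rightarrow> 's)) pmf \<Rightarrow> ('g, 's) policy \<Rightarrow> (nat \<Rightarrow> ('g, 's) snapshot) measure" where
  "crb_process sys \<iota> \<pi> = chain (crb_init \<iota> \<pi>) (crb_step sys \<pi>)"

definition objective :: "('g, 's) crb \<Rightarrow> ('g \<times> (nat \<Rightarrow> 's)) pmf \<Rightarrow> ('g, 's) policy \<Rightarrow> real" where
  "objective sys \<iota> \<pi> =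
     (\<integral>\<omega>. (\<Sum>t. \<Sum>i = 1..narms sys. discount sys ^ t *
        reward sys i (ctx_of (\<omega> t)) (states_of (\<omega> t) i) (actions_of (\<omega> t) i)) \<partial>crb_process sys \<iota> \<pi>)"

definition primal_feasible :: "('g, 's) crb \<Rightarrow> ('g \<times> (nat \<Rightarrow> 's)) pmf \<Rightarrow> ('g, 's) policy set" where
  "primal_feasible sys \<iota> = {\<pi> \<in> policies sys.
     AE \<omega> in crb_process sys \<iota> \<pi>. \<forall>t.
       (\<Sum>i = 1..narms sys. of_bool (actions_of (\<omega> t) i)) \<le> budget sys (ctx_of (\<omega> t))}"

definition relaxed_feasible :: "('g, 's) crb \<Rightarrow> ('g \<times> (nat \<Rightarrow> 's)) pmf \<Rightarrow> ('g, 's) policy set" where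
  "relaxed_feasible sys \<iota> = {\<pi> \<in> policies sys. \<forall>g.
     (\<integral>\<omega>. (\<Sum>t. discount sys ^ t * of_bool (ctx_of (\<omega> t) = g) *
        (\<Sum>i = 1..narms sys. of_bool (actions_of (\<omega> t) i))) \<partial>crb_process sys \<iota> \<pi>)
     \<le> (\<integral>\<omega>. (\<Sum>t. discount sys ^ t * of_bool (ctx_of (\<omega> t) = g)) \<partial>crb_process sys \<iota> \<pi>) * budget sys g}"

definition primal_value :: "('g, 's) crb \<Rightarrow> ('g \<times> (nat \<Rightarrow> 's)) pmf \<Rightarrow> real" where
  "primal_value sys \<iota> = (SUP \<pi>\<in>primal_feasible sys \<iota>. objective sys \<iota> \<pi>)"

definition relaxed_value :: "('g, 's) crb \<Rightarrow> ('g \<times> (nat \<Rightarrow> 's)) pmf \<Rightarrow> real" where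
  "relaxed_value sys \<iota> = (SUP \<pi>\<in>relaxed_feasible sys \<iota>. objective sys \<iota> \<pi>)"

definition relaxed_optimal :: "('g, 's) crb \<Rightarrow> ('g \<times> (nat \<Rightarrow> 's)) pmf \<Rightarrow> ('g, 's) policy \<Rightarrow> bool" where
  "relaxed_optimal sys \<iota> \<pi> \<longleftrightarrow> \<pi> \<in> relaxed_feasible sys \<iota> \<and>
     (\<forall>\<pi>'\<in>relaxed_feasible sys \<iota>. objective sys \<iota> \<pi>' \<le> objective sys \<iota> \<pi>)"

definition indep_start ::
  "('g, 's) crb \<Rightarrow> 'g pmf \<Rightarrow> ('g \<Rightarrow> 's pmf) \<Rightarrow> ('g \<times> (nat \<Rightarrow> 's)) pmf" where
  "indep_start sys \<gamma> \<mu> = do {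
     g \<leftarrow> \<gamma>;
     s \<leftarrow> Pi_pmf {1..narms sys} undefined (\<lambda>_. \<mu> g);
     return_pmf (g, s)
   }"

text \<open>For a one-arm system started from \<open>\<iota>\<close>. Conditioning on \<open>g\<^sub>t = g\<close> only makes sense at times where
  this event has positive probability, so the limit is taken along those times; they are required to
  be unbounded, as otherwise the limit would be vacuous.\<close>

definition steady_state ::
  "('g, 's) crb \<Rightarrow> ('g \<times> (nat \<Rightarrow> 's)) pmf \<Rightarrow> ('g, 's) policy \<Rightarrow> ('g \<Rightarrow> 's pmf) \<Rightarrow> bool" where
  "steady_state sys \<iota> \<pi> m \<longleftrightarrow> (\<forall>g.
     let visits = {t. \<P>(\<omega> in crb_process sys \<iota> \<pi>. ctx_of (\<omega> t) = g) > 0}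
     in infinite visits \<and>
       (\<forall>s. ((\<lambda>t. \<P>(\<omega> in crb_process sys \<iota> \<pi>. states_of (\<omega> t) 1 = s \<bar> ctx_of (\<omega> t) = g))
          \<longlongrightarrow> pmf (m g) s) (inf sequentially (principal visits))))"

end

(*
Given the contexts, which A3 forces to move along a permutation, the N relaxed arms decouple: the average
arm of any relaxed N-arm policy is, up to its discounted occupation measure, a relaxed one-arm policy, so
V_Rel(N) <= N v with v = V_Rel(1). Conversely let N shadow arms obey the optimal one-arm policy independently;
started from m they are stationary, so in each period their number of activations exceeds the budget by
O(sqrt N) in expectation. A real system that copies its shadows within the budget, and abandons an arm once
its wish is refused, loses O(sqrt N) new arms per period, which discounting sums up to O(sqrt N). This
history-dependent rule becomes a stationary policy by conditioning its occupation measure.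
*)

theory Submission
  imports Defs
begin

section \<open>Occupation measures of Markov chains\<close>

text \<open>A \<open>policy\<close> sees only the present joint state and context, so neither the
  average arm nor the shadow rule is a policy as it stands. The obstacle is removed by working with
  the law of the snapshot at an independent geometric time. The objective and the constraints depend
  on nothing else, and every distribution on snapshots with admissible actions whose state marginal
  solves one linear flow equation arises from some policy. No policy occurs in that equation, so a
  construction only has to preserve it, which projections to one arm, mixtures and the forgetting of
  hidden shadow states all do.

  Invariance of \<open>m\<close>, obtained by passing to the limit in its definition, is used twice.
  It makes the one-arm occupation measure equal to the stationary law, which turns the time-averaged
  relaxed constraint into a bound \<open>\<alpha> g\<close> on the activation probability in each
  single context. It also keeps the shadow arms independent and identically distributed given the
  context at every time, so that their number of wishes is binomial with mean at most the
  budget.\<close>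

primrec law :: "'x pmf \<Rightarrow> ('x \<Rightarrow> 'x pmf) \<Rightarrow> nat \<Rightarrow> 'x pmf" where
  "law \<nu> K 0 = \<nu>"
| "law \<nu> K (Suc t) = bind_pmf (law \<nu> K t) K"

text \<open>Histories up to time \<open>t\<close> as lists: cylinders are the events whose
  probability under \<open>chain\<close> is known explicitly, and \<open>last\<close> recovers the
  one-time marginal.\<close>

primrec path_law :: "'x pmf \<Rightarrow> ('x \<Rightarrow> 'x pmf) \<Rightarrow> nat \<Rightarrow> 'x list pmf" where
  "path_law \<nu> K 0 = map_pmf (\<lambda>x. [x]) \<nu>"
| "path_law \<nu> K (Suc t) = bind_pmf (path_law \<nu> K t) (\<lambda>xs. map_pmf (\<lambda>x. xs @ [x]) (K (last xs)))"

lemma length_path_law: "xs \<in> set_pmf (path_law \<nu> K t) \<Longrightarrow> length xs = Suc t"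
  by (induction t arbitrary: xs) auto

lemma map_last_path_law: "map_pmf last (path_law \<nu> K t) = law \<nu> K t"
proof (induction t)
  case (Suc t)
  have "map_pmf last (path_law \<nu> K (Suc t)) = bind_pmf (map_pmf last (path_law \<nu> K t)) K"
    by (simp add: map_bind_pmf pmf.map_comp o_def bind_map_pmf)
  then show ?case by (simp add: Suc)
qed (simp add: pmf.map_comp o_def)

lemma pmf_bind_map_snoc:
  "pmf (bind_pmf p (\<lambda>xs. map_pmf (\<lambda>x. xs @ [x]) (q xs))) (ys @ [z]) = pmf p ys * pmf (q ys) z"
proof -
  have "pmf (map_pmf (\<lambda>x. xs @ [x]) (q xs)) (ys @ [z]) = indicator {ys} xs * pmf (q ys) z" for xs
  proof (cases "xs = ys")
    case True
    then show ?thesis using pmf_map_inj'[of "\<lambda>x. ys @ [x]" "q ys" z] by (simp add: inj_def)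
  next
    case False
    then have "ys @ [z] \<notin> set_pmf (map_pmf (\<lambda>x. xs @ [x]) (q xs))" by auto
    with False show ?thesis by (simp add: pmf_eq_0_set_pmf)
  qed
  then show ?thesis by (simp add: pmf_bind measure_pmf_single)
qed

lemma pmf_path_law:
  "length xs = Suc n \<Longrightarrow>
    pmf (path_law \<nu> K n) xs = pmf \<nu> (xs ! 0) * (\<Prod>t<n. pmf (K (xs ! t)) (xs ! Suc t))"
proof (induction n arbitrary: xs)
  case 0
  then obtain x where "xs = [x]" by (cases xs) auto
  then show ?case using pmf_map_inj'[of "\<lambda>x. [x]" \<nu> x] by (simp add: inj_def)
next
  case (Suc n)
  then obtain ys z where xs: "xs = ys @ [z]" and ys: "length ys = Suc n"
    by (metis length_Suc_conv_rev)
  have "last ys = ys ! n" using ys by (metis diff_Suc_1 last_conv_nth list.size(3) nat.simps(3))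
  moreover have "(\<Prod>t<n. pmf (K (xs ! t)) (xs ! Suc t)) = (\<Prod>t<n. pmf (K (ys ! t)) (ys ! Suc t))"
    using ys by (intro prod.cong) (auto simp: xs nth_append)
  ultimately show ?case
    using Suc.IH[OF ys] ys by (simp add: xs pmf_bind_map_snoc nth_append)
qed

text \<open>The cylinders over the histories of positive probability that end in \<open>A\<close>
  are disjoint and contained in the event. Only the countable support is summed, since the state
  type may be uncountable; hence an inequality for now.\<close>

lemma emeasure_law_le: "emeasure (law \<nu> K n) A \<le> emeasure (chain \<nu> K) {\<omega>. \<omega> n \<in> A}"
proof -
  let ?Q = "path_law \<nu> K n" and ?S = "{xs \<in> set_pmf (path_law \<nu> K n). last xs \<in> A}"
  let ?c = "\<lambda>xs. {\<omega>. \<forall>t\<le>n. \<omega> t = xs ! t}"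
  have comp: "(\<lambda>\<omega>. \<omega> t) \<in> chain \<nu> K \<rightarrow>\<^sub>M count_space UNIV" for t
    by (rule measurable_chain_component)
  have meas: "?c xs \<in> sets (chain \<nu> K)" for xs
  proof -
    have "(\<Inter>t\<in>{..n}. (\<lambda>\<omega>. \<omega> t) -` {xs ! t} \<inter> space (chain \<nu> K)) \<in> sets (chain \<nu> K)"
      by (intro sets.finite_INT measurable_sets[OF comp]) auto
    moreover have "(\<Inter>t\<in>{..n}. (\<lambda>\<omega>. \<omega> t) -` {xs ! t} \<inter> space (chain \<nu> K)) = ?c xs" by auto
    ultimately show ?thesis by simp
  qed
  have S: "countable ?S" by (rule countable_subset[OF _ countable_set_pmf[of ?Q]]) auto
  have "emeasure (law \<nu> K n) A = emeasure ?Q {xs. last xs \<in> A}"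
    by (simp add: map_last_path_law [symmetric] vimage_def)
  also have "\<dots> = emeasure ?Q ?S"
    by (intro emeasure_eq_AE) (auto simp: AE_measure_pmf_iff)
  also have "\<dots> = (\<integral>\<^sup>+xs. emeasure ?Q {xs} \<partial>count_space ?S)"
    using S by (intro emeasure_countable_singleton) auto
  also have "\<dots> = (\<integral>\<^sup>+xs. emeasure (chain \<nu> K) (?c xs) \<partial>count_space ?S)"
    by (intro nn_integral_cong)
      (auto simp: emeasure_chain_path emeasure_pmf_single pmf_path_law length_path_law)
  also have "\<dots> = emeasure (chain \<nu> K) (\<Union>xs\<in>?S. ?c xs)"
  proof (rule emeasure_UN_countable[symmetric])
    show "disjoint_family_on ?c ?S"
    proof (unfold disjoint_family_on_def, intro ballI impI)
      fix xs ys assume *: "xs \<in> ?S" "ys \<in> ?S" "xs \<noteq> ys"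
      then have "length xs = Suc n" "length ys = Suc n" by (auto dest: length_path_law)
      with * obtain t where "t \<le> n" "xs ! t \<noteq> ys ! t"
        by (metis less_Suc_eq_le nth_equalityI)
      then show "?c xs \<inter> ?c ys = {}" by force
    qed
  qed (use S meas in auto)
  also have "\<dots> \<le> emeasure (chain \<nu> K) {\<omega>. \<omega> n \<in> A}"
  proof (rule emeasure_mono)
    show "(\<Union>xs\<in>?S. ?c xs) \<subseteq> {\<omega>. \<omega> n \<in> A}"
    proof clarify
      fix xs \<omega> assume *: "xs \<in> set_pmf ?Q" "last xs \<in> A" "\<forall>t\<le>n. \<omega> t = xs ! t"
      then have "last xs = xs ! n" using length_path_law[OF *(1)]
        by (metis diff_Suc_1 last_conv_nth list.size(3) nat.simps(3))
      with * show "\<omega> n \<in> A" by simp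
    qed
    show "{\<omega>. \<omega> n \<in> A} \<in> sets (chain \<nu> K)"
      using measurable_sets[OF comp, of A n] by (simp add: vimage_def)
  qed
  finally show ?thesis .
qed

lemma distr_chain_component:
  "distr (chain \<nu> K) (count_space UNIV) (\<lambda>\<omega>. \<omega> n) = measure_pmf (law \<nu> K n)"
proof (rule measure_eqI)
  fix A :: "'a set"
  interpret C: prob_space "chain \<nu> K" by (rule prob_space_chain)
  have comp: "(\<lambda>\<omega>. \<omega> n) \<in> chain \<nu> K \<rightarrow>\<^sub>M count_space UNIV"
    by (rule measurable_chain_component)
  have meas: "{\<omega>. \<omega> n \<in> B} \<in> sets (chain \<nu> K)" for B
    using measurable_sets[OF comp, of B] by (simp add: vimage_def)
  have le: "measure (law \<nu> K n) B \<le> measure (chain \<nu> K) {\<omega>. \<omega> n \<in> B}" for B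
    using emeasure_law_le[of \<nu> K n B]
    by (simp add: measure_pmf.emeasure_eq_measure C.emeasure_eq_measure)
  have "measure (chain \<nu> K) {\<omega>. \<omega> n \<in> - A} = 1 - measure (chain \<nu> K) {\<omega>. \<omega> n \<in> A}"
    using C.prob_compl[OF meas[of A]] by (simp add: Compl_eq_Diff_UNIV[symmetric] Collect_neg_eq)
  moreover have "measure (law \<nu> K n) (- A) = 1 - measure (law \<nu> K n) A"
    using measure_pmf.prob_compl[of A "law \<nu> K n"] by (simp add: Compl_eq_Diff_UNIV)
  \<comment> \<open>Both laws have total mass 1, so the inequalities for \<open>A\<close> and for
    its complement force equality.\<close>
  ultimately have "measure (chain \<nu> K) {\<omega>. \<omega> n \<in> A} = measure (law \<nu> K n) A"
    using le[of A] le[of "- A"] by simp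
  then show "emeasure (distr (chain \<nu> K) (count_space UNIV) (\<lambda>\<omega>. \<omega> n)) A = emeasure (law \<nu> K n) A"
    by (simp add: emeasure_distr[OF comp] vimage_def C.emeasure_eq_measure measure_pmf.emeasure_eq_measure)
qed simp

lemma integral_chain_component:
  fixes f :: "'x \<Rightarrow> real"
  shows "(\<integral>\<omega>. f (\<omega> t) \<partial>chain \<nu> K) = measure_pmf.expectation (law \<nu> K t) f"
  by (simp add: distr_chain_component[symmetric] integral_distr measurable_chain_component)

lemma prob_chain_component: "\<P>(\<omega> in chain \<nu> K. Q (\<omega> t)) = measure (law \<nu> K t) {x. Q x}"
  by (simp add: distr_chain_component[symmetric] measure_distr measurable_chain_component vimage_def)

lemma AE_chain_iff:
  "(AE \<omega> in chain \<nu> K. \<forall>t. Q (\<omega> t)) \<longleftrightarrow> (\<forall>t. \<forall>x\<in>set_pmf (law \<nu> K t). Q x)"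
proof -
  have "(AE \<omega> in chain \<nu> K. Q (\<omega> t)) \<longleftrightarrow> (\<forall>x\<in>set_pmf (law \<nu> K t). Q x)" for t
    using AE_distr_iff[OF measurable_chain_component[where t = t and \<nu> = \<nu> and K = K], of Q]
    unfolding distr_chain_component by (simp add: AE_measure_pmf_iff)
  then show ?thesis by (simp add: AE_all_countable)
qed

text \<open>Adding \<open>B\<close> makes the integrand nonnegative on the support, where the
  iterated nonnegative integral is available; \<open>B\<close> is subtracted again at the end. A
  bound on the support suffices.\<close>

lemma expectation_bind_pmf:
  fixes f :: "'b \<Rightarrow> real"
  assumes B: "\<And>y. y \<in> set_pmf (bind_pmf p q) \<Longrightarrow> \<bar>f y\<bar> \<le> B"
  shows "measure_pmf.expectation (bind_pmf p q) f =
    measure_pmf.expectation p (\<lambda>x. measure_pmf.expectation (q x) f)"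
proof -
  have int: "integrable (measure_pmf r) f" if "set_pmf r \<subseteq> set_pmf (bind_pmf p q)" for r
    using that B by (intro measure_pmf.integrable_const_bound[where B = B]) (auto simp: AE_measure_pmf_iff)
  have shift: "ennreal (measure_pmf.expectation r f + B) = (\<integral>\<^sup>+y. ennreal (f y + B) \<partial>r)"
    and nonneg: "0 \<le> measure_pmf.expectation r f + B"
    and le: "measure_pmf.expectation r f + B \<le> 2 * B"
    if r: "set_pmf r \<subseteq> set_pmf (bind_pmf p q)" for r
  proof -
    have eq: "measure_pmf.expectation r f + B = measure_pmf.expectation r (\<lambda>y. f y + B)"
      using int[OF r] by simp
    have nn: "AE y in r. 0 \<le> f y + B"
      using r B by (force simp: AE_measure_pmf_iff)
    have i: "integrable (measure_pmf r) (\<lambda>y. f y + B)" using int[OF r] by simp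
    show "ennreal (measure_pmf.expectation r f + B) = (\<integral>\<^sup>+y. ennreal (f y + B) \<partial>r)"
      unfolding eq by (rule nn_integral_eq_integral[OF i nn, symmetric])
    show "0 \<le> measure_pmf.expectation r f + B" unfolding eq by (rule integral_nonneg_AE[OF nn])
    have "measure_pmf.expectation r (\<lambda>y. f y + B) \<le> measure_pmf.expectation r (\<lambda>_. 2 * B)"
      using i r B by (intro integral_mono_AE) (force simp: AE_measure_pmf_iff)+
    then show "measure_pmf.expectation r f + B \<le> 2 * B" unfolding eq by simp
  qed
  have sub: "set_pmf (q x) \<subseteq> set_pmf (bind_pmf p q)" if "x \<in> set_pmf p" for x
    using that by auto
  let ?e = "\<lambda>x. measure_pmf.expectation (q x) f"
  have nn: "AE x in p. 0 \<le> ?e x + B" using nonneg[OF sub] by (auto simp: AE_measure_pmf_iff)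
  have ie: "integrable (measure_pmf p) (\<lambda>x. ?e x + B)"
    using nonneg[OF sub] le[OF sub]
    by (intro measure_pmf.integrable_const_bound[where B = "2 * B"]) (auto simp: AE_measure_pmf_iff)
  then have ie': "integrable (measure_pmf p) ?e"
    using Bochner_Integration.integrable_diff[OF ie, of "\<lambda>_. B"] by simp
  have "ennreal (measure_pmf.expectation (bind_pmf p q) f + B) = (\<integral>\<^sup>+x. \<integral>\<^sup>+y. ennreal (f y + B) \<partial>q x \<partial>p)"
    using shift[of "bind_pmf p q"] by simp
  also have "\<dots> = (\<integral>\<^sup>+x. ennreal (?e x + B) \<partial>p)"
    using shift[OF sub] by (intro nn_integral_cong_AE) (auto simp: AE_measure_pmf_iff)
  also have "\<dots> = ennreal (measure_pmf.expectation p (\<lambda>x. ?e x + B))"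
    by (rule nn_integral_eq_integral[OF ie nn])
  also have "\<dots> = ennreal (measure_pmf.expectation p ?e + B)" using ie' by simp
  finally show ?thesis
    using nonneg[of "bind_pmf p q"] integral_nonneg_AE[OF nn] ie' by simp
qed

section \<open>Discounted occupation measures and their flow equation\<close>

definition mixture :: "real \<Rightarrow> 'x pmf \<Rightarrow> 'x pmf \<Rightarrow> 'x pmf" where
  "mixture \<beta> p q = bind_pmf (bernoulli_pmf (1 - \<beta>)) (\<lambda>b. if b then p else q)"

text \<open>The geometric time equals \<open>t\<close> with probability
  \<open>(1 - \<beta>) * \<beta> ^ t\<close>, so this is the discounted occupation measure
  normalised to total mass 1.\<close>

definition occupation :: "real \<Rightarrow> 'x pmf \<Rightarrow> ('x \<Rightarrow> 'x pmf) \<Rightarrow> 'x pmf" where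
  "occupation \<beta> \<nu> K = bind_pmf (geometric_pmf (1 - \<beta>)) (law \<nu> K)"

lemma map_mixture: "map_pmf f (mixture \<beta> p q) = mixture \<beta> (map_pmf f p) (map_pmf f q)"
  by (auto simp: mixture_def map_bind_pmf intro!: bind_pmf_cong)

lemma bind_mixture: "bind_pmf (mixture \<beta> p q) f = mixture \<beta> (bind_pmf p f) (bind_pmf q f)"
  by (auto simp: mixture_def bind_assoc_pmf intro!: bind_pmf_cong)

lemma bind_mixture_right:
  "bind_pmf r (\<lambda>x. mixture \<beta> (p x) (q x)) = mixture \<beta> (bind_pmf r p) (bind_pmf r q)"
  unfolding mixture_def
  by (subst bind_commute_pmf) (auto intro!: bind_pmf_cong)

lemma expectation_mixture:
  fixes f :: "'x \<Rightarrow> real"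
  assumes "0 \<le> \<beta>" "\<beta> \<le> 1" "\<And>y. y \<in> set_pmf (mixture \<beta> p q) \<Longrightarrow> \<bar>f y\<bar> \<le> B"
  shows "measure_pmf.expectation (mixture \<beta> p q) f =
    (1 - \<beta>) * measure_pmf.expectation p f + \<beta> * measure_pmf.expectation q f"
  using assms unfolding mixture_def by (subst expectation_bind_pmf[of _ _ _ B]) auto

lemma pmf_mixture:
  "0 \<le> \<beta> \<Longrightarrow> \<beta> \<le> 1 \<Longrightarrow> pmf (mixture \<beta> p q) x = (1 - \<beta>) * pmf p x + \<beta> * pmf q x"
  by (simp add: mixture_def pmf_bind)

lemma law_Suc_shift: "law \<nu> K (Suc t) = law (bind_pmf \<nu> K) K t"
  by (induction t) auto

lemma law_mixture: "law (mixture \<beta> p q) K t = mixture \<beta> (law p K t) (law q K t)"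
  by (induction t) (auto simp: bind_mixture)

text \<open>A geometric time is either 0, with probability \<open>1 - \<beta>\<close>, or the
  successor of another geometric time.\<close>

lemma occupation_flow:
  assumes "0 \<le> \<beta>" "\<beta> < 1"
  shows "occupation \<beta> \<nu> K = mixture \<beta> \<nu> (bind_pmf (occupation \<beta> \<nu> K) K)"
proof -
  have "occupation \<beta> \<nu> K =
      bind_pmf (bind_pmf (bernoulli_pmf (1 - \<beta>))
        (\<lambda>b. if b then return_pmf 0 else map_pmf Suc (geometric_pmf (1 - \<beta>)))) (law \<nu> K)"
    unfolding occupation_def using assms by (subst geometric_bind_pmf_unfold) auto
  also have "\<dots> = mixture \<beta> \<nu> (bind_pmf (occupation \<beta> \<nu> K) K)"
    by (auto simp: mixture_def occupation_def bind_assoc_pmf bind_return_pmf bind_map_pmf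
        intro!: bind_pmf_cong)
  finally show ?thesis .
qed

text \<open>Two solutions differ by \<open>\<beta>\<close> times the difference of their images
  under one step. After \<open>n\<close> iterations the difference at a point is at most
  \<open>\<beta> ^ n\<close>.\<close>

lemma occupation_unique:
  assumes \<beta>: "0 \<le> \<beta>" "\<beta> < 1" and M: "M = mixture \<beta> \<nu> (bind_pmf M K)"
  shows "M = occupation \<beta> \<nu> K"
proof (rule pmf_eqI)
  fix x
  let ?M' = "occupation \<beta> \<nu> K"
  \<comment> \<open>\<open>law\<close> respects mixtures of initial distributions, and starting from
    \<open>bind_pmf p K\<close> amounts to one more step from \<open>p\<close>.\<close>
  have step: "law p K t = mixture \<beta> (law \<nu> K t) (law p K (Suc t))"
    if "p = mixture \<beta> \<nu> (bind_pmf p K)" for p t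
    by (subst that, subst law_mixture) (simp only: law_Suc_shift)
  have eq: "pmf M x - pmf ?M' x = \<beta> ^ n * (pmf (law M K n) x - pmf (law ?M' K n) x)" for n
  proof (induction n)
    case (Suc n)
    have "pmf (law p K n) x = (1 - \<beta>) * pmf (law \<nu> K n) x + \<beta> * pmf (law p K (Suc n)) x"
      if "p = mixture \<beta> \<nu> (bind_pmf p K)" for p
      using \<beta> by (subst step[OF that]) (simp add: pmf_mixture del: law.simps)
    from this[OF M] this[OF occupation_flow[OF \<beta>]]
    have "pmf (law M K n) x - pmf (law ?M' K n) x =
        \<beta> * (pmf (law M K (Suc n)) x - pmf (law ?M' K (Suc n)) x)"
      by (simp add: algebra_simps del: law.simps)
    then show ?case unfolding Suc by simp
  qed simp
  have "\<bar>pmf M x - pmf ?M' x\<bar> \<le> \<beta> ^ n" for n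
  proof -
    have "\<bar>pmf (law M K n) x - pmf (law ?M' K n) x\<bar> \<le> 1"
      using pmf_nonneg[of "law M K n" x] pmf_nonneg[of "law ?M' K n" x]
        pmf_le_1[of "law M K n" x] pmf_le_1[of "law ?M' K n" x] by linarith
    then show ?thesis using \<beta> unfolding eq[of n] abs_mult
      by (simp add: mult_left_le)
  qed
  moreover have "(\<lambda>n. \<beta> ^ n) \<longlonglongrightarrow> 0" using \<beta> by (intro LIMSEQ_power_zero) auto
  ultimately have "\<bar>pmf M x - pmf ?M' x\<bar> \<le> 0"
    by (intro LIMSEQ_le_const) auto
  then show "pmf M x = pmf ?M' x" by simp
qed

lemma map_law:
  assumes "\<And>x. map_pmf f (K x) = K' (f x)"
  shows "map_pmf f (law \<nu> K t) = law (map_pmf f \<nu>) K' t"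
  by (induction t) (auto simp: map_bind_pmf assms bind_map_pmf simp flip: bind_map_pmf)

text \<open>A step made of two halves \<open>k\<close> and \<open>f\<close> can be observed after
  either half. Here \<open>f\<close> will be the choice of actions and \<open>k\<close> the
  transition, which passes between snapshots and states.\<close>

lemma law_bind:
  "law (bind_pmf \<nu> f) (\<lambda>y. bind_pmf (k y) f) t = bind_pmf (law \<nu> (\<lambda>x. bind_pmf (f x) k) t) f"
  by (induction t) (auto simp: bind_assoc_pmf)

lemma occupation_invariant: "bind_pmf \<nu> K = \<nu> \<Longrightarrow> occupation \<beta> \<nu> K = \<nu>"
proof -
  assume *: "bind_pmf \<nu> K = \<nu>"
  have "law \<nu> K t = \<nu>" for t by (induction t) (auto simp: *)
  then have "law \<nu> K = (\<lambda>_. \<nu>)" by (rule ext)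
  then show ?thesis by (simp add: occupation_def)
qed

lemma map_occupation:
  assumes "\<And>x. map_pmf f (K x) = K' (f x)"
  shows "map_pmf f (occupation \<beta> \<nu> K) = occupation \<beta> (map_pmf f \<nu>) K'"
  by (simp add: occupation_def map_bind_pmf map_law[where f = f and K' = K', OF assms])

lemma set_occupation:
  assumes "0 < \<beta>" "\<beta> < 1"
  shows "set_pmf (occupation \<beta> \<nu> K) = (\<Union>t. set_pmf (law \<nu> K t))"
  using assms by (auto simp: occupation_def set_pmf_geometric)

text \<open>The series is dominated by \<open>\<beta> ^ t * B\<close>, so sum and integral may be
  exchanged; the divisor \<open>1 - \<beta>\<close> undoes the normalisation of
  \<open>occupation\<close>.\<close>

lemma integral_discounted_chain:
  fixes f :: "'x \<Rightarrow> real"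
  assumes \<beta>: "0 \<le> \<beta>" "\<beta> < 1" and B: "\<And>x. \<bar>f x\<bar> \<le> B"
  shows "(\<integral>\<omega>. (\<Sum>t. \<beta> ^ t * f (\<omega> t)) \<partial>chain \<nu> K) =
    measure_pmf.expectation (occupation \<beta> \<nu> K) f / (1 - \<beta>)"
proof -
  interpret C: prob_space "chain \<nu> K" by (rule prob_space_chain)
  have [measurable]: "(\<lambda>\<omega>. \<omega> t) \<in> chain \<nu> K \<rightarrow>\<^sub>M count_space UNIV" for t
    by (rule measurable_chain_component)
  have fm [measurable]: "(\<lambda>\<omega>. f (\<omega> t)) \<in> borel_measurable (chain \<nu> K)" for t
    by (rule measurable_compose[OF measurable_chain_component]) simp
  have B0: "0 \<le> B" using B[of undefined] by linarith
  have bound: "norm (\<beta> ^ t * f (\<omega> t)) \<le> \<beta> ^ t * B" for \<omega> t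
    using \<beta> B by (simp add: abs_mult mult_left_mono)
  have sumB: "summable (\<lambda>t. \<beta> ^ t * B)" using \<beta> by (intro summable_mult2 summable_geometric) auto
  have int: "integrable (chain \<nu> K) (\<lambda>\<omega>. \<beta> ^ t * f (\<omega> t))" for t
    using bound by (intro C.integrable_const_bound[where B = "\<beta> ^ t * B"]) auto
  have "(\<integral>\<omega>. (\<Sum>t. \<beta> ^ t * f (\<omega> t)) \<partial>chain \<nu> K) = (\<Sum>t. \<integral>\<omega>. \<beta> ^ t * f (\<omega> t) \<partial>chain \<nu> K)"
  proof (rule integral_suminf[OF int])
    show "AE \<omega> in chain \<nu> K. summable (\<lambda>t. norm (\<beta> ^ t * f (\<omega> t)))"
      using bound by (intro AE_I2 summable_comparison_test'[OF sumB]) auto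
    have "norm (\<integral>\<omega>. norm (\<beta> ^ t * f (\<omega> t)) \<partial>chain \<nu> K) \<le> \<beta> ^ t * B" for t
    proof -
      have "(\<integral>\<omega>. norm (\<beta> ^ t * f (\<omega> t)) \<partial>chain \<nu> K) \<le> (\<integral>\<omega>. \<beta> ^ t * B \<partial>chain \<nu> K)"
        using int bound by (intro integral_mono) auto
      then show ?thesis using C.prob_space by simp
    qed
    then show "summable (\<lambda>t. \<integral>\<omega>. norm (\<beta> ^ t * f (\<omega> t)) \<partial>chain \<nu> K)"
      by (intro summable_comparison_test'[OF sumB]) auto
  qed
  also have "\<dots> = (\<Sum>t. \<beta> ^ t * measure_pmf.expectation (law \<nu> K t) f)"
    by (simp add: integral_chain_component)
  finally have 1: "(\<integral>\<omega>. (\<Sum>t. \<beta> ^ t * f (\<omega> t)) \<partial>chain \<nu> K) =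
      (\<Sum>t. \<beta> ^ t * measure_pmf.expectation (law \<nu> K t) f)" .
  let ?e = "\<lambda>t. measure_pmf.expectation (law \<nu> K t) f"
  have e: "\<bar>?e t\<bar> \<le> B" for t
  proof -
    have "\<bar>?e t\<bar> \<le> measure_pmf.expectation (law \<nu> K t) (\<lambda>x. \<bar>f x\<bar>)" by (rule integral_abs_bound)
    also have "\<dots> \<le> measure_pmf.expectation (law \<nu> K t) (\<lambda>_. B)"
      using B B0 by (intro integral_mono measure_pmf.integrable_const_bound[where B = B]) auto
    finally show ?thesis by simp
  qed
  have "measure_pmf.expectation (occupation \<beta> \<nu> K) f =
      measure_pmf.expectation (geometric_pmf (1 - \<beta>)) ?e"
    unfolding occupation_def using B by (intro expectation_bind_pmf) auto
  also have "\<dots> = (\<integral>t. pmf (geometric_pmf (1 - \<beta>)) t * ?e t \<partial>count_space UNIV)"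
    by (simp add: measure_pmf_eq_density integral_density)
  also have "\<dots> = (\<Sum>t. pmf (geometric_pmf (1 - \<beta>)) t * ?e t)"
  proof (rule integral_count_space_nat)
    have "integrable (measure_pmf (geometric_pmf (1 - \<beta>))) ?e"
      using e by (intro measure_pmf.integrable_const_bound[where B = B]) auto
    then show "integrable (count_space UNIV) (\<lambda>t. pmf (geometric_pmf (1 - \<beta>)) t * ?e t)"
      by (simp add: measure_pmf_eq_density integrable_density)
  qed
  also have "\<dots> = (\<Sum>t. (1 - \<beta>) * (\<beta> ^ t * ?e t))"
    using \<beta> by (intro suminf_cong) simp
  also have "\<dots> = (1 - \<beta>) * (\<Sum>t. \<beta> ^ t * ?e t)"
    using \<beta> e by (intro suminf_mult summable_comparison_test'[OF sumB])
      (auto simp: abs_mult mult_left_mono)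
  finally show ?thesis unfolding 1 using \<beta> by simp
qed

text \<open>Disintegration of \<open>M\<close> along \<open>f\<close>. Along \<open>state_of\<close>
  the conditional laws are the action choices of a policy.\<close>

lemma bind_cond_pmf_fibres:
  "bind_pmf (map_pmf f M) (\<lambda>x. cond_pmf M {y. f y = x}) = M"
proof (rule bind_cond_pmf_cancel)
  fix x y assume "f y = x" and "x \<in> set_pmf (map_pmf f M)"
  then show "measure M {y. f y = x} = measure (map_pmf f M) {x. f y = x}"
    by (simp add: vimage_def)
qed auto

section \<open>Restless bandits in terms of occupation measures\<close>

definition state_of :: "('g, 's) snapshot \<Rightarrow> 'g \<times> (nat \<Rightarrow> 's)" where
  "state_of y = (ctx_of y, states_of y)"

text \<open>The half of a step that no policy influences; \<open>play\<close> is the other half. The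
  common kernel \<open>P\<close> is a parameter, so that systems of different size can be
  compared.\<close>

definition state_kernel ::
  "nat \<Rightarrow> ('g \<Rightarrow> 'g pmf) \<Rightarrow> ('g \<Rightarrow> 's \<Rightarrow> bool \<Rightarrow> 's pmf) \<Rightarrow> ('g, 's) snapshot \<Rightarrow> ('g \<times> (nat \<Rightarrow> 's)) pmf" where
  "state_kernel n G P y = do {
     g' \<leftarrow> G (ctx_of y);
     s' \<leftarrow> Pi_pmf {1..n} undefined (\<lambda>i. P (ctx_of y) (states_of y i) (actions_of y i));
     return_pmf (g', s')
   }"

definition play :: "('g, 's) policy \<Rightarrow> 'g \<times> (nat \<Rightarrow> 's) \<Rightarrow> ('g, 's) snapshot pmf" where
  "play \<pi> x = map_pmf (\<lambda>a. (fst x, snd x, a)) (\<pi> (snd x) (fst x))"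

definition crb_occupation ::
  "('g, 's) crb \<Rightarrow> ('g \<times> (nat \<Rightarrow> 's)) pmf \<Rightarrow> ('g, 's) policy \<Rightarrow> ('g, 's) snapshot pmf" where
  "crb_occupation S \<iota> \<pi> = occupation (discount S) (crb_init \<iota> \<pi>) (crb_step S \<pi>)"

lemma crb_init_play: "crb_init \<iota> \<pi> = bind_pmf \<iota> (play \<pi>)"
  by (auto simp: crb_init_def play_def map_pmf_def intro!: bind_pmf_cong)

lemma abs_sum_arms_le:
  fixes f :: "nat \<Rightarrow> real"
  assumes "\<And>i. \<bar>f i\<bar> \<le> B"
  shows "\<bar>\<Sum>i = 1..n. f i\<bar> \<le> n * B"
proof -
  have "\<bar>\<Sum>i = 1..n. f i\<bar> \<le> (\<Sum>i = 1..n. \<bar>f i\<bar>)" by (rule sum_abs)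
  also have "\<dots> \<le> (\<Sum>i = 1..n. B)" using assms by (rule sum_mono)
  finally show ?thesis by simp
qed

lemma finite_arm_bounded:
  fixes h :: "'g::finite \<Rightarrow> 's::finite \<Rightarrow> bool \<Rightarrow> real"
  obtains B where "\<And>g s a. \<bar>h g s a\<bar> \<le> B"
proof -
  let ?h = "\<lambda>(g, s, a). \<bar>h g s a\<bar>"
  have "\<bar>h g s a\<bar> \<le> Max (range ?h)" for g s a
    by (intro Max_ge) (auto intro!: rev_image_eqI[of "(g, s, a)"])
  then show thesis by (rule that)
qed

locale identical_arms =
  fixes S :: "('g::finite, 's::finite) crb" and n :: nat
    and G :: "'g \<Rightarrow> 'g pmf"
    and P :: "'g \<Rightarrow> 's \<Rightarrow> bool \<Rightarrow> 's pmf"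
    and R :: "'g \<Rightarrow> 's \<Rightarrow> bool \<Rightarrow> real"
    and \<beta> :: real
  assumes narms: "narms S = n"
    and ctx_kernel: "ctx_kernel S = G"
    and discount: "discount S = \<beta>"
    and discount_pos: "0 < \<beta>" and discount_less: "\<beta> < 1"
    and arms: "i \<in> {1..n} \<Longrightarrow> arm_kernel S i = P \<and> reward S i = R"
begin

lemma crb_step_play: "crb_step S \<pi> = (\<lambda>y. bind_pmf (state_kernel n G P y) (play \<pi>))"
proof (rule ext)
  fix y :: "('g, 's) snapshot"
  have "Pi_pmf {1..n} undefined (\<lambda>i. arm_kernel S i (ctx_of y) (states_of y i) (actions_of y i)) =
      Pi_pmf {1..n} undefined (\<lambda>i. P (ctx_of y) (states_of y i) (actions_of y i))"
    using arms by (intro Pi_pmf_cong) auto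
  then show "crb_step S \<pi> y = bind_pmf (state_kernel n G P y) (play \<pi>)"
    by (cases y) (simp add: crb_step_def state_kernel_def play_def map_pmf_def narms ctx_kernel
        bind_assoc_pmf bind_return_pmf)
qed

lemma objective_occupation:
  "objective S \<iota> \<pi> =
    measure_pmf.expectation (crb_occupation S \<iota> \<pi>)
      (\<lambda>y. \<Sum>i = 1..n. R (ctx_of y) (states_of y i) (actions_of y i)) / (1 - \<beta>)"
proof -
  obtain B where B: "\<And>g s a. \<bar>R g s a\<bar> \<le> B" using finite_arm_bounded[of R] by blast
  have eq: "(\<Sum>i = 1..narms S. discount S ^ t *
        reward S i (ctx_of y) (states_of y i) (actions_of y i)) =
      \<beta> ^ t * (\<Sum>i = 1..n. R (ctx_of y) (states_of y i) (actions_of y i))" for t y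
    unfolding sum_distrib_left using arms by (intro sum.cong) (auto simp: narms discount)
  show ?thesis
    unfolding objective_def crb_process_def crb_occupation_def eq unfolding discount
    using discount_pos discount_less abs_sum_arms_le[OF B]
    by (intro integral_discounted_chain[where B = "n * B"]) auto
qed

lemma relaxed_feasible_iff:
  "\<pi> \<in> relaxed_feasible S \<iota> \<longleftrightarrow> \<pi> \<in> policies S \<and> (\<forall>g.
     measure_pmf.expectation (crb_occupation S \<iota> \<pi>)
       (\<lambda>y. of_bool (ctx_of y = g) * (\<Sum>i = 1..n. of_bool (actions_of y i))) \<le>
     measure_pmf.expectation (crb_occupation S \<iota> \<pi>) (\<lambda>y. of_bool (ctx_of y = g)) * budget S g)"
proof -
  have sum_le: "\<bar>\<Sum>i = 1..n. of_bool (actions_of y i) :: real\<bar> \<le> n" for y :: "('g, 's) snapshot"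
    using abs_sum_arms_le[of "\<lambda>i. of_bool (actions_of y i)" 1 n] by simp
  have 1: "(\<integral>\<omega>. (\<Sum>t. \<beta> ^ t * of_bool (ctx_of (\<omega> t) = g) *
      (\<Sum>i = 1..n. of_bool (actions_of (\<omega> t) i))) \<partial>crb_process S \<iota> \<pi>) =
    measure_pmf.expectation (crb_occupation S \<iota> \<pi>)
       (\<lambda>y. of_bool (ctx_of y = g) * (\<Sum>i = 1..n. of_bool (actions_of y i))) / (1 - \<beta>)" for g
    unfolding crb_process_def crb_occupation_def discount mult.assoc
    using discount_pos discount_less sum_le
    by (intro integral_discounted_chain[where B = n]) (auto simp: abs_mult)
  have 2: "(\<integral>\<omega>. (\<Sum>t. \<beta> ^ t * of_bool (ctx_of (\<omega> t) = g)) \<partial>crb_process S \<iota> \<pi>) =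
    measure_pmf.expectation (crb_occupation S \<iota> \<pi>) (\<lambda>y. of_bool (ctx_of y = g)) / (1 - \<beta>)" for g
    unfolding crb_process_def crb_occupation_def discount
    using discount_pos discount_less by (intro integral_discounted_chain[where B = 1]) auto
  show ?thesis
    unfolding relaxed_feasible_def narms discount mem_Collect_eq 1 2
    using discount_less by (simp add: divide_le_cancel)
qed

text \<open>Since \<open>\<beta>\<close> is positive, the support of the occupation measure is the
  union of the supports at all times, so an almost sure constraint at all times is a constraint on
  this support.\<close>

lemma primal_feasible_iff:
  "\<pi> \<in> primal_feasible S \<iota> \<longleftrightarrow> \<pi> \<in> policies S \<and>
    (\<forall>y\<in>set_pmf (crb_occupation S \<iota> \<pi>).
      (\<Sum>i = 1..n. of_bool (actions_of y i)) \<le> budget S (ctx_of y))"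
  unfolding primal_feasible_def crb_process_def crb_occupation_def mem_Collect_eq narms discount
    AE_chain_iff[where Q = "\<lambda>y. (\<Sum>i = 1..n. of_bool (actions_of y i)) \<le> budget S (ctx_of y)"]
    set_occupation[OF discount_pos discount_less]
  by blast

lemma primal_subset_relaxed: "primal_feasible S \<iota> \<subseteq> relaxed_feasible S \<iota>"
proof
  fix \<pi> assume "\<pi> \<in> primal_feasible S \<iota>"
  then have \<pi>: "\<pi> \<in> policies S"
    and le: "\<And>y. y \<in> set_pmf (crb_occupation S \<iota> \<pi>) \<Longrightarrow>
      (\<Sum>i = 1..n. of_bool (actions_of y i)) \<le> budget S (ctx_of y)"
    unfolding primal_feasible_iff by auto
  let ?M = "crb_occupation S \<iota> \<pi>"
  have "measure_pmf.expectation ?M (\<lambda>y. of_bool (ctx_of y = g) * (\<Sum>i = 1..n. of_bool (actions_of y i)))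
      \<le> measure_pmf.expectation ?M (\<lambda>y. of_bool (ctx_of y = g) * budget S g)" for g
  proof (rule integral_mono_AE)
    have "\<bar>\<Sum>i = 1..n. of_bool (actions_of y i) :: real\<bar> \<le> n" for y :: "('g, 's) snapshot"
      using abs_sum_arms_le[of "\<lambda>i. of_bool (actions_of y i)" 1 n] by simp
    then show "integrable ?M (\<lambda>y. of_bool (ctx_of y = g) * (\<Sum>i = 1..n. of_bool (actions_of y i)) :: real)"
      by (intro measure_pmf.integrable_const_bound[where B = n]) (auto simp: abs_mult)
    show "integrable ?M (\<lambda>y. of_bool (ctx_of y = g) * budget S g)"
      by (intro measure_pmf.integrable_const_bound[where B = "\<bar>budget S g\<bar>"]) (auto simp: abs_mult)
    show "AE y in ?M. of_bool (ctx_of y = g) * (\<Sum>i = 1..n. of_bool (actions_of y i)) \<le> of_bool (ctx_of y = g) * budget S g"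
      using le by (auto simp: AE_measure_pmf_iff)
  qed
  then show "\<pi> \<in> relaxed_feasible S \<iota>"
    using \<pi> unfolding relaxed_feasible_iff by simp
qed

text \<open>Forgetting the actions in the flow equation cancels \<open>play\<close>, and with it
  every mention of the policy.\<close>

lemma map_state_occupation:
  "map_pmf state_of (crb_occupation S \<iota> \<pi>) =
    mixture \<beta> \<iota> (bind_pmf (crb_occupation S \<iota> \<pi>) (state_kernel n G P))"
proof -
  have st: "map_pmf state_of (bind_pmf p (play \<pi>)) = p" for p
    by (simp add: map_bind_pmf play_def pmf.map_comp o_def state_of_def map_pmf_const bind_return_pmf')
  have "crb_occupation S \<iota> \<pi> = mixture \<beta> (bind_pmf \<iota> (play \<pi>))
      (bind_pmf (bind_pmf (crb_occupation S \<iota> \<pi>) (state_kernel n G P)) (play \<pi>))"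
    unfolding crb_occupation_def crb_init_play crb_step_play discount bind_assoc_pmf
    using discount_pos discount_less by (intro occupation_flow) auto
  then have "map_pmf state_of (crb_occupation S \<iota> \<pi>) = map_pmf state_of (mixture \<beta> (bind_pmf \<iota> (play \<pi>))
      (bind_pmf (bind_pmf (crb_occupation S \<iota> \<pi>) (state_kernel n G P)) (play \<pi>)))"
    by (rule arg_cong)
  then show ?thesis by (simp only: map_mixture st)
qed

text \<open>The policy is read off from the conditional action probabilities of \<open>M\<close>.\<close>

lemma flow_policy:
  assumes flow: "map_pmf state_of M = mixture \<beta> \<iota> (bind_pmf M (state_kernel n G P))"
    and ext: "\<And>y. y \<in> set_pmf M \<Longrightarrow> actions_of y \<in> {1..n} \<rightarrow>\<^sub>E UNIV"
  obtains \<pi> where "\<pi> \<in> policies S" "crb_occupation S \<iota> \<pi> = M"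
proof -
  define C where "C x = cond_pmf M {y. state_of y = x}" for x
  \<comment> \<open>At states outside the support of \<open>M\<close> all arms are passive; any
    admissible action would do, but \<open>policies\<close> asks for one.\<close>
  define \<pi> :: "('g, 's) policy" where
    "\<pi> s g = (if (g, s) \<in> state_of ` set_pmf M then map_pmf actions_of (C (g, s))
      else return_pmf (restrict (\<lambda>_. False) {1..n}))" for s g
  have set_C: "set_pmf (C x) = set_pmf M \<inter> {y. state_of y = x}" if "x \<in> state_of ` set_pmf M" for x
    unfolding C_def using that by (intro set_cond_pmf) auto
  have play: "play \<pi> x = C x" if x: "x \<in> state_of ` set_pmf M" for x
  proof -
    have "play \<pi> x = map_pmf (\<lambda>y. (fst x, snd x, actions_of y)) (C x)"
      using x by (simp add: play_def \<pi>_def pmf.map_comp o_def)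
    also have "\<dots> = map_pmf (\<lambda>y. y) (C x)"
      using set_C[OF x] by (intro map_pmf_cong) (auto simp: state_of_def)
    finally show ?thesis by simp
  qed
  \<comment> \<open>Once the conditional laws are recognised as \<open>play \<pi>\<close>, the flow
    on states lifts to the flow equation of the snapshot chain of \<open>\<pi>\<close>, whose
    solution is unique.\<close>
  have "M = bind_pmf (map_pmf state_of M) C"
    unfolding C_def by (rule bind_cond_pmf_fibres[symmetric])
  also have "\<dots> = bind_pmf (map_pmf state_of M) (play \<pi>)"
    using play by (intro bind_pmf_cong) auto
  also have "\<dots> = mixture \<beta> (bind_pmf \<iota> (play \<pi>)) (bind_pmf M (\<lambda>y. bind_pmf (state_kernel n G P y) (play \<pi>)))"
    unfolding flow bind_mixture by (simp add: bind_assoc_pmf)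
  finally have "M = crb_occupation S \<iota> \<pi>"
    unfolding crb_occupation_def crb_init_play crb_step_play discount
    using discount_pos discount_less by (intro occupation_unique) auto
  moreover have "\<pi> \<in> policies S"
  proof -
    have "set_pmf (\<pi> s g) \<subseteq> {1..n} \<rightarrow>\<^sub>E UNIV" for s g
    proof (cases "(g, s) \<in> state_of ` set_pmf M")
      case True
      then have "set_pmf (\<pi> s g) \<subseteq> actions_of ` set_pmf M"
        unfolding \<pi>_def using set_C[OF True] by auto
      then show ?thesis using ext by blast
    qed (simp add: \<pi>_def)
    then show ?thesis unfolding policies_def narms by blast
  qed
  ultimately show thesis using that by blast
qed

end

section \<open>Periodic contexts and the stationary arm\<close>

text \<open>The uniform start charges every context, so a path along possible transitions has a
  cylinder of positive probability and cannot avoid an almost sure property. The path runs to time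
  \<open>Suc T\<close> in order to compare its second point as well.\<close>

lemma periodic_path:
  fixes G :: "'g::finite \<Rightarrow> 'g pmf"
  assumes period: "AE \<omega> in chain (pmf_of_set UNIV) G. \<forall>t. \<omega> (t + T) = \<omega> t"
    and path: "\<And>t. t \<le> T \<Longrightarrow> x (Suc t) \<in> set_pmf (G (x t))"
  shows "x T = x 0" and "x (Suc T) = x 1"
proof -
  let ?C = "chain (pmf_of_set UNIV) G"
  let ?A = "\<lambda>\<omega>. \<forall>t\<le>Suc T. \<omega> t = x t"
  have "measure ?C {\<omega>. ?A \<omega>} > 0"
    unfolding chain_path using path
    by (intro mult_pos_pos prod_pos) (auto simp: pmf_positive_iff)
  have False if "\<not> (x T = x 0 \<and> x (Suc T) = x 1)"
  proof -
    have "AE \<omega> in ?C. \<not> ?A \<omega>"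
      using period
    proof (rule eventually_mono)
      fix \<omega> :: "nat \<Rightarrow> 'g" assume *: "\<forall>t. \<omega> (t + T) = \<omega> t"
      show "\<not> ?A \<omega>"
      proof
        assume A: "?A \<omega>"
        have "x T = x 0" using *[rule_format, of 0] A by simp
        moreover have "x (Suc T) = x 1" using *[rule_format, of 1] A by simp
        ultimately show False using that by simp
      qed
    qed
    then have "emeasure ?C {\<omega> \<in> space ?C. ?A \<omega>} = 0" by (rule emeasure_eq_0_AE)
    with \<open>measure ?C {\<omega>. ?A \<omega>} > 0\<close> show False by (simp add: measure_def)
  qed
  then show "x T = x 0" "x (Suc T) = x 1" by auto
qed

lemma periodic_chain_permutation:
  fixes G :: "'g::finite \<Rightarrow> 'g pmf"
  assumes T: "T \<ge> 1"
    and period: "AE \<omega> in chain (pmf_of_set UNIV) G. \<forall>t. \<omega> (t + T) = \<omega> t"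
  obtains \<sigma> where "bij \<sigma>" "\<And>g. G g = return_pmf (\<sigma> g)"
proof -
  define \<sigma> where "\<sigma> g = (SOME y. y \<in> set_pmf (G g))" for g
  have \<sigma>: "\<sigma> g \<in> set_pmf (G g)" for g
    unfolding \<sigma>_def using set_pmf_not_empty[of "G g"] by (simp add: some_in_eq)
  have unique: "z = y" if "y \<in> set_pmf (G g)" "z \<in> set_pmf (G g)" for g y z
  proof -
    \<comment> \<open>From \<open>g\<close> go to \<open>y\<close> and continue by arbitrary
      possible transitions: periodicity brings this path back to \<open>g\<close> at time
      \<open>T\<close>. There \<open>z\<close> may be chosen as the next context, and periodicity
      identifies it with the context at time 1, which is \<open>y\<close>.\<close>
    define x where "x t = (case t of 0 \<Rightarrow> g | Suc t \<Rightarrow> (\<sigma> ^^ t) y)" for t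
    have step: "x (Suc t) \<in> set_pmf (G (x t))" for t
      using that(1) \<sigma> by (cases t) (auto simp: x_def)
    have xT: "x T = g" using periodic_path(1)[OF period, of x] step by (simp add: x_def)
    define x' where "x' = x(Suc T := z)"
    have "x' (Suc t) \<in> set_pmf (G (x' t))" if t: "t \<le> T" for t
    proof (cases "t = T")
      case True
      then show ?thesis using \<open>z \<in> set_pmf (G g)\<close> xT by (simp add: x'_def)
    next
      case False
      then have "x' (Suc t) = x (Suc t)" "x' t = x t" using t by (simp_all add: x'_def)
      then show ?thesis using step[of t] by simp
    qed
    then have "x' (Suc T) = x' 1" by (rule periodic_path(2)[OF period])
    then show "z = y" using T by (simp add: x'_def x_def)
  qed
  have G: "G g = return_pmf (\<sigma> g)" for g
  proof -
    have "set_pmf (G g) \<subseteq> {\<sigma> g}" using unique[OF \<sigma>] by blast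
    then show ?thesis by (simp add: set_pmf_subset_singleton)
  qed
  \<comment> \<open>A map with \<open>\<sigma> ^^ T\<close> the identity is onto, and on a finite
    type this makes it a permutation.\<close>
  have "(\<sigma> ^^ T) g = g" for g
    using periodic_path(1)[OF period, of "\<lambda>t. (\<sigma> ^^ t) g"] by (simp add: G)
  moreover have "\<sigma> ((\<sigma> ^^ (T - 1)) g) = (\<sigma> ^^ T) g" for g
    using T by (cases T) simp_all
  ultimately have surj: "surj \<sigma>" by (metis surjI)
  then have "bij \<sigma>" by (intro bijI finite_UNIV_surj_inj) simp_all
  then show thesis using G that by blast
qed

abbreviation uniform :: "'g::finite pmf" where "uniform \<equiv> pmf_of_set UNIV"

lemma map_uniform: "bij \<sigma> \<Longrightarrow> map_pmf \<sigma> uniform = uniform"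
  by (simp add: map_pmf_of_set_inj bij_is_inj bij_is_surj)

section \<open>The one-arm system as a finite chain, and its steady state\<close>

definition one_arm :: "'s \<Rightarrow> nat \<Rightarrow> 's" where "one_arm x = (\<lambda>_. undefined)(1 := x)"

definition arm_policy :: "('g, 's) policy \<Rightarrow> 'g \<Rightarrow> 's \<Rightarrow> bool pmf" where
  "arm_policy \<pi> g s = map_pmf (\<lambda>a. a 1) (\<pi> (one_arm s) g)"

definition arm_dist :: "('g \<Rightarrow> 's \<Rightarrow> bool pmf) \<Rightarrow> ('g \<Rightarrow> 's pmf) \<Rightarrow> 'g \<Rightarrow> ('s \<times> bool) pmf" where
  "arm_dist p m g = bind_pmf (m g) (\<lambda>s. map_pmf (Pair s) (p g s))"

lemma one_arm_apply [simp]: "one_arm x 1 = x" "one_arm x (Suc 0) = x"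
  by (simp_all add: one_arm_def)

lemma Pi_pmf_one_arm: "Pi_pmf {1..1} undefined p = map_pmf one_arm (p 1)"
proof -
  have "(\<lambda>y. if y = 1 then x else undefined) = one_arm x" for x :: 'a
    by (auto simp: one_arm_def)
  then show ?thesis by (simp add: Pi_pmf_singleton)
qed

locale permuted_contexts = identical_arms S n G P R \<beta>
  for S :: "('g::finite, 's::finite) crb" and n G P R \<beta> +
  fixes \<sigma> :: "'g \<Rightarrow> 'g"
  assumes bij: "bij \<sigma>" and G: "G g = return_pmf (\<sigma> g)"
begin

definition arm_chain :: "('g \<Rightarrow> 's \<Rightarrow> bool pmf) \<Rightarrow> 'g \<times> 's \<Rightarrow> ('g \<times> 's) pmf" where
  "arm_chain p x = map_pmf (Pair (\<sigma> (fst x))) (bind_pmf (p (fst x) (snd x)) (P (fst x) (snd x)))"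

text \<open>Embedding a state as \<open>one_arm\<close> carries one step of \<open>arm_chain\<close>
  to a choice of actions followed by a transition. This leaves a chain on a finite type in which the
  action is averaged out.\<close>

lemma law_one_arm:
  assumes n: "n = 1"
  shows "law (crb_init (map_pmf (map_prod id one_arm) \<iota>) \<pi>) (crb_step S \<pi>) t =
    bind_pmf (map_pmf (map_prod id one_arm) (law \<iota> (arm_chain (arm_policy \<pi>)) t)) (play \<pi>)"
proof -
  let ?e = "map_prod id one_arm :: 'g \<times> 's \<Rightarrow> _"
  have k: "state_kernel n G P y =
      map_pmf (\<lambda>x. (\<sigma> (ctx_of y), one_arm x)) (P (ctx_of y) (states_of y 1) (actions_of y 1))" for y
    by (simp add: state_kernel_def G bind_return_pmf n Pi_pmf_one_arm[simplified] map_pmf_def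
        bind_assoc_pmf)
  have "map_pmf ?e (arm_chain (arm_policy \<pi>) x) = bind_pmf (play \<pi> (?e x)) (state_kernel n G P)" for x
    by (simp add: k arm_chain_def arm_policy_def play_def map_bind_pmf bind_map_pmf pmf.map_comp o_def)
  then have "map_pmf ?e (law \<iota> (arm_chain (arm_policy \<pi>)) t) =
      law (map_pmf ?e \<iota>) (\<lambda>x. bind_pmf (play \<pi> x) (state_kernel n G P)) t"
    by (rule map_law)
  then show ?thesis by (simp add: crb_init_play crb_step_play law_bind)
qed

lemma indep_start_one_arm:
  "n = 1 \<Longrightarrow> indep_start S \<gamma> \<mu> =
    map_pmf (map_prod id one_arm) (bind_pmf \<gamma> (\<lambda>g. map_pmf (Pair g) (\<mu> g)))"
  by (simp add: indep_start_def narms Pi_pmf_one_arm[simplified] map_bind_pmf pmf.map_comp o_def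
      map_pmf_def bind_assoc_pmf bind_return_pmf)

text \<open>Injectivity of \<open>\<sigma>\<close> leaves \<open>g\<close> as the only context that
  can precede \<open>\<sigma> g\<close>.\<close>

lemma pmf_arm_chain_step:
  "pmf (bind_pmf q (arm_chain p)) (\<sigma> g, s') =
    (\<Sum>s\<in>UNIV. pmf q (g, s) * pmf (bind_pmf (p g s) (P g s)) s')"
proof -
  have inj: "\<sigma> h = \<sigma> g \<longleftrightarrow> h = g" for h
    by (rule inj_eq) (use bij in \<open>simp add: bij_def\<close>)
  have one: "pmf (arm_chain p (h, s)) (\<sigma> g, s') =
      (if h = g then pmf (bind_pmf (p g s) (P g s)) s' else 0)" for h s
  proof (cases "h = g")
    case True
    have "inj (Pair (\<sigma> g) :: 's \<Rightarrow> _)" by (rule injI) simp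
    then show ?thesis
      by (simp only: arm_chain_def True fst_conv snd_conv if_True simp_thms pmf_map_inj')
  next
    case False
    then have "\<sigma> h \<noteq> \<sigma> g" using inj[of h] by simp
    moreover have "fst x = \<sigma> h" if "x \<in> set_pmf (arm_chain p (h, s))" for x
      using that by (auto simp: arm_chain_def)
    ultimately have "(\<sigma> g, s') \<notin> set_pmf (arm_chain p (h, s))" by fastforce
    with False show ?thesis by (simp add: pmf_eq_0_set_pmf)
  qed
  have "pmf (bind_pmf q (arm_chain p)) (\<sigma> g, s') =
      (\<Sum>x\<in>UNIV. pmf (arm_chain p x) (\<sigma> g, s') * pmf q x)"
    unfolding pmf_bind[of q] by (rule integral_measure_pmf_real) simp_all
  also have "\<dots> = (\<Sum>h\<in>UNIV. \<Sum>s\<in>UNIV. pmf (arm_chain p (h, s)) (\<sigma> g, s') * pmf q (h, s))"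
    unfolding sum.cartesian_product UNIV_Times_UNIV by (intro sum.cong) auto
  also have "\<dots> = (\<Sum>h\<in>UNIV. if h = g then
      (\<Sum>s\<in>UNIV. pmf (bind_pmf (p g s) (P g s)) s' * pmf q (g, s)) else 0)"
    by (intro sum.cong) (auto simp: one)
  finally show ?thesis by (simp add: mult.commute)
qed

text \<open>Conditioned on the context, the state law at time \<open>t + 1\<close> in
  \<open>\<sigma> g\<close> is a fixed finite linear image of the one at time \<open>t\<close> in
  \<open>g\<close>. Both converge, to \<open>m (\<sigma> g)\<close> and to the image of
  \<open>m g\<close>.\<close>

lemma steady_state_invariant:
  assumes n: "n = 1" and steady: "steady_state S (indep_start S \<gamma> \<mu>) \<pi> m"
  shows "bind_pmf (m g) (\<lambda>s. bind_pmf (arm_policy \<pi> g s) (P g s)) = m (\<sigma> g)"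
proof (rule pmf_eqI)
  fix s'
  let ?p = "arm_policy \<pi>"
  \<comment> \<open>\<open>L t\<close> is the law of context and state, \<open>c t g\<close> the
    probability of context \<open>g\<close>, \<open>r t g\<close> the conditional state law, and
    \<open>F g\<close> the filter of late times at which \<open>g\<close> has positive
    probability.\<close>
  define L where "L = law (bind_pmf \<gamma> (\<lambda>g. map_pmf (Pair g) (\<mu> g))) (arm_chain ?p)"
  define c where "c t g = measure (L t) {x. fst x = g}" for t g
  define r where "r t g s = pmf (L t) (g, s) / c t g" for t g s
  define V where "V g = {t. c t g > 0}" for g
  define F where "F g = inf sequentially (principal (V g))" for g
  let ?C = "crb_process S (indep_start S \<gamma> \<mu>) \<pi>"
  have proj: "map_pmf (\<lambda>y. (ctx_of y, states_of y 1)) (bind_pmf (map_pmf (map_prod id one_arm) q) (play \<pi>)) = q"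
    for q
    by (simp add: bind_map_pmf map_bind_pmf play_def pmf.map_comp o_def map_pmf_const bind_return_pmf')
  have prob: "\<P>(\<omega> in ?C. Q (ctx_of (\<omega> t)) (states_of (\<omega> t) 1)) = measure (L t) {x. Q (fst x) (snd x)}"
    for Q :: "'g \<Rightarrow> 's \<Rightarrow> bool" and t
    unfolding crb_process_def prob_chain_component[where Q = "\<lambda>y. Q (ctx_of y) (states_of y 1)"]
      indep_start_one_arm[OF n] law_one_arm[OF n] L_def[symmetric]
  proof -
    let ?q = "bind_pmf (map_pmf (map_prod id one_arm) (L t)) (play \<pi>)"
    have "measure (map_pmf (\<lambda>y. (ctx_of y, states_of y 1)) ?q) {x. Q (fst x) (snd x)} =
        measure ?q {y. Q (ctx_of y) (states_of y 1)}"
      by (simp add: vimage_def)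
    then show "measure ?q {y. Q (ctx_of y) (states_of y 1)} = measure (L t) {x. Q (fst x) (snd x)}"
      by (simp only: proj)
  qed
  have c: "\<P>(\<omega> in ?C. ctx_of (\<omega> t) = h) = c t h" for t h
    using prob[of "\<lambda>g _. g = h" t] by (simp add: c_def)
  have r: "\<P>(\<omega> in ?C. states_of (\<omega> t) 1 = s \<bar> ctx_of (\<omega> t) = h) = r t h s" for t h s
  proof -
    have "\<P>(\<omega> in ?C. states_of (\<omega> t) 1 = s \<and> ctx_of (\<omega> t) = h) = measure (L t) {x. snd x = s \<and> fst x = h}"
      using prob[of "\<lambda>g s'. s' = s \<and> g = h" t] by simp
    also have "{x. snd x = s \<and> fst x = h} = {(h, s)}" by auto
    finally show ?thesis by (simp add: cond_prob_def c r_def measure_pmf_single)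
  qed
  have inf: "infinite (V h)" and lim: "((\<lambda>t. r t h s) \<longlongrightarrow> pmf (m h) s) (F h)" for h s
    using steady unfolding steady_state_def Let_def c r V_def F_def by auto
  have inj: "inj \<sigma>" using bij by (simp add: bij_def)
  have c_Suc: "c (Suc t) (\<sigma> g) = c t g" for t
  proof -
    have c_pmf: "c t h = pmf (map_pmf fst (L t)) h" for t h
      by (simp add: c_def pmf_map vimage_def)
    have "map_pmf fst (arm_chain ?p x) = return_pmf (\<sigma> (fst x))" for x
      by (simp add: arm_chain_def pmf.map_comp o_def map_pmf_const)
    then have "map_pmf fst (L (Suc t)) = map_pmf \<sigma> (map_pmf fst (L t))"
      unfolding L_def law.simps map_bind_pmf pmf.map_comp by (simp add: map_pmf_def)
    then show ?thesis by (simp add: c_pmf pmf_map_inj'[OF inj])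
  qed
  have r_Suc: "r (Suc t) (\<sigma> g) s' = (\<Sum>s\<in>UNIV. r t g s * pmf (bind_pmf (?p g s) (P g s)) s')" for t
    unfolding r_def c_Suc sum_divide_distrib
    by (simp add: L_def pmf_arm_chain_step sum_divide_distrib)
  \<comment> \<open>Because \<open>c (Suc t) (\<sigma> g) = c t g\<close>, shifting time by one maps
    the visits of \<open>g\<close> into those of \<open>\<sigma> g\<close>.\<close>
  have "filterlim Suc (F (\<sigma> g)) (F g)"
    unfolding F_def filterlim_inf
  proof
    show "filterlim Suc sequentially (inf sequentially (principal (V g)))"
      using filterlim_Suc by (rule filterlim_mono) auto
    show "filterlim Suc (principal (V (\<sigma> g))) (inf sequentially (principal (V g)))"
      unfolding filterlim_principal eventually_inf_principal by (auto simp: V_def c_Suc)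
  qed
  from filterlim_compose[OF lim this]
  have shifted: "((\<lambda>t. r (Suc t) (\<sigma> g) s') \<longlongrightarrow> pmf (m (\<sigma> g)) s') (F g)" .
  have pushed: "((\<lambda>t. r (Suc t) (\<sigma> g) s') \<longlongrightarrow>
      (\<Sum>s\<in>UNIV. pmf (m g) s * pmf (bind_pmf (?p g s) (P g s)) s')) (F g)"
    unfolding r_Suc by (intro tendsto_sum tendsto_mult_right lim)
  \<comment> \<open>Infinitely many visits make the filter proper, without which limits would not be
    unique.\<close>
  have "F g \<noteq> bot"
    using inf[of g] unfolding F_def trivial_limit_def eventually_inf_principal eventually_sequentially
    by (metis finite_nat_set_iff_bounded not_less)
  from tendsto_unique[OF this shifted pushed]
  have "pmf (m (\<sigma> g)) s' = (\<Sum>s\<in>UNIV. pmf (m g) s * pmf (bind_pmf (?p g s) (P g s)) s')" .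
  also have "\<dots> = pmf (bind_pmf (m g) (\<lambda>s. bind_pmf (?p g s) (P g s))) s'"
    unfolding pmf_bind[of "m g"] by (subst integral_measure_pmf_real[of UNIV]) (auto simp: mult.commute)
  finally show "pmf (bind_pmf (m g) (\<lambda>s. bind_pmf (?p g s) (P g s))) s' = pmf (m (\<sigma> g)) s'" by simp
qed

text \<open>The permutation preserves the uniform law of the context and \<open>m\<close> is carried
  along it, so the chain starts in equilibrium and its law at a geometric time is its law at any
  time.\<close>

lemma occupation_invariant_arm:
  assumes n: "n = 1"
    and m: "\<And>g. bind_pmf (m g) (\<lambda>s. bind_pmf (arm_policy \<pi> g s) (P g s)) = m (\<sigma> g)"
  shows "map_pmf (\<lambda>y. (ctx_of y, states_of y 1, actions_of y 1))
      (crb_occupation S (indep_start S uniform m) \<pi>) =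
    bind_pmf uniform (\<lambda>g. map_pmf (Pair g) (arm_dist (arm_policy \<pi>) m g))"
proof -
  let ?\<iota> = "bind_pmf uniform (\<lambda>g. map_pmf (Pair g) (m g))"
  let ?K = "arm_chain (arm_policy \<pi>)"
  have "bind_pmf (map_pmf (Pair g) (m g)) ?K = map_pmf (Pair (\<sigma> g)) (m (\<sigma> g))" for g
    unfolding m[of g, symmetric] arm_chain_def bind_map_pmf map_bind_pmf by simp
  then have "bind_pmf ?\<iota> ?K = bind_pmf uniform (\<lambda>g. map_pmf (Pair (\<sigma> g)) (m (\<sigma> g)))"
    by (simp add: bind_assoc_pmf)
  also have "\<dots> = bind_pmf (map_pmf \<sigma> uniform) (\<lambda>g. map_pmf (Pair g) (m g))"
    by (simp add: bind_map_pmf)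
  finally have inv: "bind_pmf ?\<iota> ?K = ?\<iota>" by (simp add: map_uniform[OF bij])
  have "law ?\<iota> ?K t = ?\<iota>" for t by (induction t) (auto simp: inv)
  then have "law (crb_init (indep_start S uniform m) \<pi>) (crb_step S \<pi>) =
      (\<lambda>_. bind_pmf (map_pmf (map_prod id one_arm) ?\<iota>) (play \<pi>))"
    by (simp add: fun_eq_iff indep_start_one_arm[OF n] law_one_arm[OF n])
  then have "crb_occupation S (indep_start S uniform m) \<pi> =
      bind_pmf (map_pmf (map_prod id one_arm) ?\<iota>) (play \<pi>)"
    by (simp add: crb_occupation_def occupation_def)
  then show ?thesis
    by (simp add: arm_dist_def arm_policy_def play_def bind_map_pmf map_bind_pmf bind_assoc_pmf
        pmf.map_comp o_def)
qed

end

section \<open>The average arm\<close>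

definition one_arm_snapshot :: "nat \<Rightarrow> ('g, 's) snapshot \<Rightarrow> ('g, 's) snapshot" where
  "one_arm_snapshot i y = (ctx_of y, one_arm (states_of y i), one_arm (actions_of y i))"

definition average_arm :: "nat \<Rightarrow> ('g, 's) snapshot pmf \<Rightarrow> ('g, 's) snapshot pmf" where
  "average_arm n M = bind_pmf (pmf_of_set {1..n}) (\<lambda>i. map_pmf (one_arm_snapshot i) M)"

text \<open>Each arm moves by a kernel that depends only on the context, its own state and its own
  action, so its projection solves the one-arm flow equation even if its actions depend on the other
  arms. The equation is affine with the same start for every arm, so it survives averaging over a
  uniformly chosen arm.\<close>

lemma average_arm_flow:
  assumes n: "n \<ge> 1" and narms: "narms S = n" "narms S' = 1"
    and flow: "map_pmf state_of M = mixture \<beta> (indep_start S \<gamma> \<mu>) (bind_pmf M (state_kernel n G P))"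
  shows "map_pmf state_of (average_arm n M) =
    mixture \<beta> (indep_start S' \<gamma> \<mu>) (bind_pmf (average_arm n M) (state_kernel 1 G P))"
proof -
  define sel where "sel i x = (fst x, one_arm (snd x i))" for i and x :: "'a \<times> (nat \<Rightarrow> 'b)"
  have kernel: "map_pmf (sel i) (state_kernel n G P y) = state_kernel 1 G P (one_arm_snapshot i y)"
    if i: "i \<in> {1..n}" for i y
  proof -
    let ?p = "\<lambda>i. P (ctx_of y) (states_of y i) (actions_of y i)"
    have "map_pmf (sel i) (state_kernel n G P y) = bind_pmf (G (ctx_of y))
        (\<lambda>g. map_pmf (\<lambda>x. (g, one_arm x)) (map_pmf (\<lambda>s. s i) (Pi_pmf {1..n} undefined ?p)))"
      by (simp add: state_kernel_def map_bind_pmf sel_def map_pmf_def bind_assoc_pmf bind_return_pmf)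
    also have "\<dots> = bind_pmf (G (ctx_of y)) (\<lambda>g. map_pmf (\<lambda>x. (g, one_arm x)) (?p i))"
      using i by (subst Pi_pmf_component) auto
    also have "\<dots> = state_kernel 1 G P (one_arm_snapshot i y)"
      unfolding state_kernel_def Pi_pmf_one_arm
      by (simp add: one_arm_snapshot_def map_pmf_def bind_assoc_pmf bind_return_pmf)
    finally show ?thesis .
  qed
  have start: "map_pmf (sel i) (indep_start S \<gamma> \<mu>) = indep_start S' \<gamma> \<mu>" if i: "i \<in> {1..n}" for i
  proof -
    have "map_pmf (sel i) (indep_start S \<gamma> \<mu>) = bind_pmf \<gamma>
        (\<lambda>g. map_pmf (\<lambda>x. (g, one_arm x)) (map_pmf (\<lambda>s. s i) (Pi_pmf {1..n} undefined (\<lambda>_. \<mu> g))))"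
      by (simp add: indep_start_def narms map_bind_pmf sel_def map_pmf_def bind_assoc_pmf bind_return_pmf)
    also have "\<dots> = bind_pmf \<gamma> (\<lambda>g. map_pmf (\<lambda>x. (g, one_arm x)) (\<mu> g))"
      using i by (subst Pi_pmf_component) auto
    also have "\<dots> = indep_start S' \<gamma> \<mu>"
      unfolding indep_start_def narms Pi_pmf_one_arm
      by (simp add: map_pmf_def bind_assoc_pmf bind_return_pmf)
    finally show ?thesis .
  qed
  have arm: "map_pmf state_of (map_pmf (one_arm_snapshot i) M) = mixture \<beta> (indep_start S' \<gamma> \<mu>)
      (bind_pmf (map_pmf (one_arm_snapshot i) M) (state_kernel 1 G P))" if i: "i \<in> {1..n}" for i
  proof -
    have "map_pmf state_of (map_pmf (one_arm_snapshot i) M) = map_pmf (sel i) (map_pmf state_of M)"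
      by (simp add: pmf.map_comp o_def state_of_def sel_def one_arm_snapshot_def)
    also have "\<dots> = mixture \<beta> (indep_start S' \<gamma> \<mu>) (bind_pmf (map_pmf (one_arm_snapshot i) M) (state_kernel 1 G P))"
      unfolding flow map_mixture start[OF i] map_bind_pmf bind_map_pmf kernel[OF i] ..
    finally show ?thesis .
  qed
  have "map_pmf state_of (average_arm n M) =
      bind_pmf (pmf_of_set {1..n}) (\<lambda>i. map_pmf state_of (map_pmf (one_arm_snapshot i) M))"
    by (simp add: average_arm_def map_bind_pmf)
  also have "\<dots> = bind_pmf (pmf_of_set {1..n}) (\<lambda>i. mixture \<beta> (indep_start S' \<gamma> \<mu>)
      (bind_pmf (map_pmf (one_arm_snapshot i) M) (state_kernel 1 G P)))"
    using n by (intro bind_pmf_cong refl arm) auto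
  also have "\<dots> = mixture \<beta> (indep_start S' \<gamma> \<mu>) (bind_pmf (average_arm n M) (state_kernel 1 G P))"
    by (simp add: bind_mixture_right average_arm_def bind_assoc_pmf)
  finally show ?thesis .
qed

lemma expectation_average_arm:
  fixes h :: "'g::finite \<Rightarrow> 's::finite \<Rightarrow> bool \<Rightarrow> real"
  assumes n: "n \<ge> 1"
  shows "measure_pmf.expectation (average_arm n M)
      (\<lambda>y. \<Sum>i = 1..1. h (ctx_of y) (states_of y i) (actions_of y i)) =
    measure_pmf.expectation M (\<lambda>y. \<Sum>i = 1..n. h (ctx_of y) (states_of y i) (actions_of y i)) / n"
proof -
  obtain B where B: "\<And>g s a. \<bar>h g s a\<bar> \<le> B" using finite_arm_bounded[of h] by blast
  have "measure_pmf.expectation (average_arm n M)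
      (\<lambda>y. \<Sum>i = 1..1. h (ctx_of y) (states_of y i) (actions_of y i)) =
    measure_pmf.expectation (pmf_of_set {1..n}) (\<lambda>i. measure_pmf.expectation M
      (\<lambda>y. h (ctx_of y) (states_of y i) (actions_of y i)))"
    unfolding average_arm_def using B
    by (subst expectation_bind_pmf[of _ _ _ B]) (auto simp: one_arm_snapshot_def)
  also have "\<dots> = (\<Sum>i = 1..n. measure_pmf.expectation M
      (\<lambda>y. h (ctx_of y) (states_of y i) (actions_of y i))) / n"
    using n by (subst integral_pmf_of_set) auto
  also have "(\<Sum>i = 1..n. measure_pmf.expectation M
      (\<lambda>y. h (ctx_of y) (states_of y i) (actions_of y i))) =
    measure_pmf.expectation M (\<lambda>y. \<Sum>i = 1..n. h (ctx_of y) (states_of y i) (actions_of y i))"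
    using B by (intro Bochner_Integration.integral_sum[symmetric] measure_pmf.integrable_const_bound[where B = B]) auto
  finally show ?thesis .
qed

lemma map_ctx_average_arm: "map_pmf ctx_of (average_arm n M) = map_pmf ctx_of M"
  by (simp add: average_arm_def map_bind_pmf pmf.map_comp o_def one_arm_snapshot_def)

text \<open>Averaging leaves the context law unchanged and divides activations and rewards by
  \<open>n\<close>; since the budget scales with \<open>n\<close>, the constraint passes to the
  single arm.\<close>

lemma relaxed_average_arm:
  assumes n: "n \<ge> 1" and one: "identical_arms S' 1 G P R \<beta>" and many: "identical_arms S n G P R \<beta>"
    and budget: "\<And>g. budget S g = budget S' g * n"
    and \<pi>: "\<pi> \<in> relaxed_feasible S (indep_start S \<gamma> \<mu>)"
  obtains \<pi>' where "\<pi>' \<in> relaxed_feasible S' (indep_start S' \<gamma> \<mu>)"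
    "objective S (indep_start S \<gamma> \<mu>) \<pi> = n * objective S' (indep_start S' \<gamma> \<mu>) \<pi>'"
proof -
  interpret one: identical_arms S' 1 G P R \<beta> by (rule one)
  interpret many: identical_arms S n G P R \<beta> by (rule many)
  let ?M = "crb_occupation S (indep_start S \<gamma> \<mu>) \<pi>"
  have "actions_of y \<in> {1..1} \<rightarrow>\<^sub>E UNIV" if "y \<in> set_pmf (average_arm n ?M)" for y
    using that by (auto simp: average_arm_def one_arm_snapshot_def one_arm_def)
  with average_arm_flow[OF n many.narms one.narms many.map_state_occupation]
  obtain \<pi>' where \<pi>': "\<pi>' \<in> policies S'" "crb_occupation S' (indep_start S' \<gamma> \<mu>) \<pi>' = average_arm n ?M"
    by (rule one.flow_policy)
  have ctx: "measure_pmf.expectation (average_arm n ?M) (\<lambda>y. of_bool (ctx_of y = g)) =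
      measure_pmf.expectation ?M (\<lambda>y. of_bool (ctx_of y = g) :: real)" for g
    using arg_cong[OF map_ctx_average_arm, of "\<lambda>p. measure_pmf.expectation p (\<lambda>h. of_bool (h = g) :: real)" n ?M]
    by simp
  have act: "measure_pmf.expectation (average_arm n ?M)
        (\<lambda>y. of_bool (ctx_of y = g) * (\<Sum>i = 1..1. of_bool (actions_of y i))) =
      measure_pmf.expectation ?M
        (\<lambda>y. of_bool (ctx_of y = g) * (\<Sum>i = 1..n. of_bool (actions_of y i))) / real n" for g
    using expectation_average_arm[OF n, of ?M "\<lambda>h _ a. of_bool (h = g) * of_bool a"]
    unfolding sum_distrib_left .
  have "\<pi>' \<in> relaxed_feasible S' (indep_start S' \<gamma> \<mu>)"
    unfolding one.relaxed_feasible_iff \<pi>'(2) ctx act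
    using \<pi> \<pi>'(1) n unfolding many.relaxed_feasible_iff budget
    by (auto simp: divide_le_eq mult.assoc)
  moreover have "objective S (indep_start S \<gamma> \<mu>) \<pi> = n * objective S' (indep_start S' \<gamma> \<mu>) \<pi>'"
    unfolding one.objective_occupation many.objective_occupation \<pi>'(2) expectation_average_arm[OF n]
    using n by simp
  ultimately show thesis by (rule that)
qed

section \<open>Coupling with independent shadow arms\<close>

text \<open>The variance, by adding one Bernoulli trial at a time: the cross terms cancel and each
  trial contributes \<open>q * (1 - q)\<close>.\<close>

lemma expectation_binomial_square:
  assumes q: "0 \<le> q" "q \<le> 1"
  shows "measure_pmf.expectation (binomial_pmf n q) (\<lambda>k. (real k - q * n)\<^sup>2) = n * (q * (1 - q))"
proof (induction n)
  case 0
  then show ?case using q by (simp add: binomial_pmf_0)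
next
  case (Suc n)
  let ?B = "binomial_pmf n q"
  have int: "integrable (measure_pmf ?B) f" for f :: "nat \<Rightarrow> real"
    using q by (intro integrable_measure_pmf_finite) (simp add: set_pmf_binomial_eq)
  define C where "C = Max ((\<lambda>k. \<bar>(real k - q * Suc n)\<^sup>2\<bar>) ` set_pmf (binomial_pmf (Suc n) q))"
  have "finite (set_pmf (binomial_pmf (Suc n) q))" using q by (simp add: set_pmf_binomial_eq)
  then have C: "\<bar>(real k - q * Suc n)\<^sup>2\<bar> \<le> C" if "k \<in> set_pmf (binomial_pmf (Suc n) q)" for k
    unfolding C_def using that by (intro Max_ge finite_imageI imageI)
  have "measure_pmf.expectation (binomial_pmf (Suc n) q) (\<lambda>k. (real k - q * Suc n)\<^sup>2) =
      measure_pmf.expectation (bernoulli_pmf q) (\<lambda>b. measure_pmf.expectation ?B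
        (\<lambda>k. (real ((if b then 1 else 0) + k) - q * Suc n)\<^sup>2))"
  proof -
    have eq: "binomial_pmf (Suc n) q =
        bind_pmf (bernoulli_pmf q) (\<lambda>b. map_pmf (\<lambda>k. (if b then 1 else 0) + k) ?B)"
      using q by (simp add: binomial_pmf_Suc map_pmf_def)
    show ?thesis using C unfolding eq by (subst expectation_bind_pmf[of _ _ _ C]) auto
  qed
  also have "\<dots> = measure_pmf.expectation ?B (\<lambda>k. q * (real (1 + k) - q * Suc n)\<^sup>2 + (1 - q) * (real k - q * Suc n)\<^sup>2)"
    using q int by simp
  also have "\<dots> = measure_pmf.expectation ?B (\<lambda>k. (real k - q * n)\<^sup>2 + q * (1 - q))"
    by (intro Bochner_Integration.integral_cong) (auto simp: power2_eq_square algebra_simps)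
  also have "\<dots> = Suc n * (q * (1 - q))"
    using int by (simp add: Suc algebra_simps)
  finally show ?case .
qed

lemma expectation_binomial_deviation:
  assumes q: "0 \<le> q" "q \<le> 1" and n: "n \<ge> 1"
  shows "measure_pmf.expectation (binomial_pmf n q) (\<lambda>k. \<bar>real k - q * n\<bar>) \<le> sqrt n"
proof -
  let ?B = "binomial_pmf n q"
  have int: "integrable (measure_pmf ?B) f" for f :: "nat \<Rightarrow> real"
    using q by (intro integrable_measure_pmf_finite) (simp add: set_pmf_binomial_eq)
  \<comment> \<open>This replaces Jensen's inequality; the weight \<open>sqrt n\<close> balances a
    variance of at most \<open>n\<close> against the constant term.\<close>
  have am_gm: "\<bar>x\<bar> \<le> (x\<^sup>2 / sqrt n + sqrt n) / 2" for x
  proof -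
    have "0 \<le> (\<bar>x\<bar> - sqrt n)\<^sup>2" by simp
    then have "2 * \<bar>x\<bar> * sqrt n \<le> x\<^sup>2 + sqrt n * sqrt n"
      by (simp add: power2_diff)
    then show ?thesis using n by (simp add: field_simps)
  qed
  have "measure_pmf.expectation ?B (\<lambda>k. \<bar>real k - q * n\<bar>) \<le>
      measure_pmf.expectation ?B (\<lambda>k. ((real k - q * n)\<^sup>2 / sqrt n + sqrt n) / 2)"
    by (intro integral_mono int am_gm)
  also have "\<dots> = (n * (q * (1 - q)) / sqrt n + sqrt n) / 2"
    using int by (simp add: expectation_binomial_square[OF q])
  also have "n * (q * (1 - q)) / sqrt n \<le> n * 1 / sqrt n"
  proof -
    have "q * (1 - q) \<le> 1" using q by (intro mult_le_one) auto
    then show ?thesis using mult_left_mono[of "q * (1 - q)" 1 "real n"]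
      by (intro divide_right_mono) auto
  qed
  also have "n * 1 / sqrt n = sqrt n" by (simp add: real_div_sqrt)
  finally show ?thesis by simp
qed

section \<open>Granting wishes within the budget, and counting the arms that deviate\<close>

definition capped :: "nat \<Rightarrow> 'a set \<Rightarrow> 'a set" where
  "capped k A = (SOME B. B \<subseteq> A \<and> card B = min (card A) k)"

lemma capped: "capped k A \<subseteq> A" "card (capped k A) = min (card A) k"
proof -
  have "\<exists>B. B \<subseteq> A \<and> card B = min (card A) k"
    by (meson min.cobounded1 obtain_subset_with_card_n)
  then have "capped k A \<subseteq> A \<and> card (capped k A) = min (card A) k"
    unfolding capped_def by (rule someI_ex)
  then show "capped k A \<subseteq> A" "card (capped k A) = min (card A) k" by auto
qed

text \<open>The coupled system gives every arm a triple: the state of a shadow arm that always obeys the one-arm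
  policy \<open>p\<close>, the state of the real arm, and the action wished for by the shadow arm. A real arm that is out
  of step with its shadow stays passive, and among the others at most \<open>\<kappa> g\<close> wishes are granted. The two
  copies only separate when a wish is refused, and then they move independently.\<close>

type_synonym 's arm_pair = "'s \<times> 's \<times> bool"

abbreviation shadow_of :: "'s arm_pair \<Rightarrow> 's" where "shadow_of z \<equiv> fst z"
abbreviation real_of :: "'s arm_pair \<Rightarrow> 's" where "real_of z \<equiv> fst (snd z)"
abbreviation wish_of :: "'s arm_pair \<Rightarrow> bool" where "wish_of z \<equiv> snd (snd z)"

context permuted_contexts
begin

definition granted :: "('g \<Rightarrow> nat) \<Rightarrow> 'g \<times> (nat \<Rightarrow> 's arm_pair) \<Rightarrow> nat \<Rightarrow> bool" where
  "granted \<kappa> y = restrict (\<lambda>i. i \<in> capped (\<kappa> (fst y))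
     {i \<in> {1..n}. shadow_of (snd y i) = real_of (snd y i) \<and> wish_of (snd y i)}) {1..n}"

text \<open>Either branch has the prescribed marginals, so neither copy alone notices the coupling.
  An arm whose wish was refused may meet its shadow again by chance and then counts as in
  step.\<close>

definition couple :: "'g \<Rightarrow> 's arm_pair \<Rightarrow> bool \<Rightarrow> ('s \<times> 's) pmf" where
  "couple g z a = (if shadow_of z = real_of z \<and> wish_of z = a
     then map_pmf (\<lambda>x. (x, x)) (P g (real_of z) a)
     else pair_pmf (P g (shadow_of z) (wish_of z)) (P g (real_of z) a))"

definition couple_arm :: "('g \<Rightarrow> 's \<Rightarrow> bool pmf) \<Rightarrow> 'g \<Rightarrow> 's arm_pair \<Rightarrow> bool \<Rightarrow> 's arm_pair pmf" where
  "couple_arm p g z a =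
     bind_pmf (couple g z a) (\<lambda>x. map_pmf (\<lambda>b. (fst x, snd x, b)) (p (\<sigma> g) (fst x)))"

text \<open>The default is a triple of \<open>undefined\<close>s, not \<open>undefined\<close>
  itself, so that its projections are the defaults of the joint states and of the shadow
  pairs.\<close>

definition coupled_start ::
  "('g \<Rightarrow> 's \<Rightarrow> bool pmf) \<Rightarrow> ('g \<Rightarrow> 's pmf) \<Rightarrow> ('g \<times> (nat \<Rightarrow> 's arm_pair)) pmf" where
  "coupled_start p m = bind_pmf uniform (\<lambda>g. map_pmf (Pair g)
     (Pi_pmf {1..n} (undefined, undefined, undefined)
       (\<lambda>_. map_pmf (\<lambda>(s, b). (s, s, b)) (arm_dist p m g))))"

definition coupled_step ::
  "('g \<Rightarrow> nat) \<Rightarrow> ('g \<Rightarrow> 's \<Rightarrow> bool pmf) \<Rightarrow> 'g \<times> (nat \<Rightarrow> 's arm_pair) \<Rightarrow> ('g \<times> (nat \<Rightarrow> 's arm_pair)) pmf" where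
  "coupled_step \<kappa> p y = map_pmf (Pair (\<sigma> (fst y)))
     (Pi_pmf {1..n} (undefined, undefined, undefined)
       (\<lambda>i. couple_arm p (fst y) (snd y i) (granted \<kappa> y i)))"

definition coupled ::
  "('g \<Rightarrow> nat) \<Rightarrow> ('g \<Rightarrow> 's \<Rightarrow> bool pmf) \<Rightarrow> ('g \<Rightarrow> 's pmf) \<Rightarrow> ('g \<times> (nat \<Rightarrow> 's arm_pair)) pmf" where
  "coupled \<kappa> p m = occupation \<beta> (coupled_start p m) (coupled_step \<kappa> p)"

definition real_snapshot :: "('g \<Rightarrow> nat) \<Rightarrow> 'g \<times> (nat \<Rightarrow> 's arm_pair) \<Rightarrow> ('g, 's) snapshot" where
  "real_snapshot \<kappa> y = (fst y, (\<lambda>i. real_of (snd y i)), granted \<kappa> y)"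

definition shadow_arms :: "'g \<times> (nat \<Rightarrow> 's arm_pair) \<Rightarrow> 'g \<times> (nat \<Rightarrow> 's \<times> bool)" where
  "shadow_arms y = (fst y, (\<lambda>i. (shadow_of (snd y i), wish_of (snd y i))))"

definition desync :: "'g \<times> (nat \<Rightarrow> 's arm_pair) \<Rightarrow> nat" where
  "desync y = card {i \<in> {1..n}. shadow_of (snd y i) \<noteq> real_of (snd y i)}"

definition deviating :: "('g \<Rightarrow> nat) \<Rightarrow> 'g \<times> (nat \<Rightarrow> 's arm_pair) \<Rightarrow> nat" where
  "deviating \<kappa> y =
     card {i \<in> {1..n}. shadow_of (snd y i) \<noteq> real_of (snd y i) \<or> wish_of (snd y i) \<noteq> granted \<kappa> y i}"

text \<open>Subtraction on \<open>nat\<close> truncates at 0, so this is the positive part of wishes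
  minus budget.\<close>

definition excess :: "('g \<Rightarrow> nat) \<Rightarrow> 'g \<times> (nat \<Rightarrow> 's \<times> bool) \<Rightarrow> nat" where
  "excess \<kappa> x = card {i \<in> {1..n}. snd (snd x i)} - \<kappa> (fst x)"

lemma map_fst_couple: "map_pmf fst (couple g z a) = P g (shadow_of z) (wish_of z)"
  by (simp add: couple_def pmf.map_comp o_def map_fst_pair_pmf)

lemma map_snd_couple: "map_pmf snd (couple g z a) = P g (real_of z) a"
  by (simp add: couple_def pmf.map_comp o_def map_snd_pair_pmf)

lemma card_granted: "card {i \<in> {1..n}. granted \<kappa> y i} \<le> \<kappa> (fst y)"
proof -
  let ?A = "{i \<in> {1..n}. shadow_of (snd y i) = real_of (snd y i) \<and> wish_of (snd y i)}"
  have "{i \<in> {1..n}. granted \<kappa> y i} = capped (\<kappa> (fst y)) ?A"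
    using capped(1)[of "\<kappa> (fst y)" ?A] by (auto simp: granted_def)
  then show ?thesis by (simp add: capped(2))
qed

text \<open>An arm in step deviates only if its wish is refused. Wishes of arms out of step consume
  no budget, so the refusals are at most the excess of all shadow wishes.\<close>

lemma deviating_le: "deviating \<kappa> y \<le> desync y + excess \<kappa> (shadow_arms y)"
proof -
  let ?A = "{i \<in> {1..n}. shadow_of (snd y i) = real_of (snd y i) \<and> wish_of (snd y i)}"
  let ?D = "{i \<in> {1..n}. shadow_of (snd y i) \<noteq> real_of (snd y i)}"
  let ?C = "capped (\<kappa> (fst y)) ?A"
  have C: "?C \<subseteq> ?A" by (rule capped)
  have "{i \<in> {1..n}. shadow_of (snd y i) \<noteq> real_of (snd y i) \<or> wish_of (snd y i) \<noteq> granted \<kappa> y i}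
      \<subseteq> ?D \<union> (?A - ?C)"
    using C by (auto simp: granted_def)
  then have "deviating \<kappa> y \<le> card (?D \<union> (?A - ?C))"
    unfolding deviating_def by (intro card_mono) auto
  also have "\<dots> \<le> desync y + card (?A - ?C)"
    unfolding desync_def by (rule card_Un_le)
  also have "card (?A - ?C) = card ?A - card ?C"
    using C by (intro card_Diff_subset finite_subset[OF C]) auto
  also have "\<dots> \<le> card {i \<in> {1..n}. wish_of (snd y i)} - \<kappa> (fst y)"
  proof -
    have "card ?A \<le> card {i \<in> {1..n}. wish_of (snd y i)}" by (intro card_mono) auto
    then show ?thesis by (simp add: capped(2))
  qed
  finally show ?thesis by (simp add: excess_def shadow_arms_def)
qed

text \<open>An arm in step whose wish is followed, be it active or passive, moves together with its
  shadow; this bound holds for every outcome.\<close>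

lemma desync_step:
  assumes "y' \<in> set_pmf (coupled_step \<kappa> p y)"
  shows "desync y' \<le> deviating \<kappa> y"
proof -
  obtain h where y': "y' = (\<sigma> (fst y), h)"
    and h: "\<And>i. i \<in> {1..n} \<Longrightarrow> h i \<in> set_pmf (couple_arm p (fst y) (snd y i) (granted \<kappa> y i))"
    using assms by (auto simp: coupled_step_def set_Pi_pmf PiE_dflt_def)
  have "shadow_of (h i) = real_of (h i)"
    if "i \<in> {1..n}" "shadow_of (snd y i) = real_of (snd y i)" "wish_of (snd y i) = granted \<kappa> y i" for i
    using h[OF that(1)] that(2,3) by (auto simp: couple_arm_def couple_def)
  then show ?thesis
    unfolding desync_def deviating_def y' by (intro card_mono) auto
qed

lemma desync_start:
  assumes "y \<in> set_pmf (coupled_start p m)"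
  shows "desync y = 0"
proof -
  have "shadow_of (snd y i) = real_of (snd y i)" if "i \<in> {1..n}" for i
    using assms that by (auto simp: coupled_start_def set_Pi_pmf PiE_dflt_def)
  then show ?thesis by (simp add: desync_def)
qed

lemma desync_le: "desync y \<le> n" and deviating_le_n: "deviating \<kappa> y \<le> n" and excess_le: "excess \<kappa> x \<le> n"
proof -
  have "card {i \<in> {1..n}. Q i} \<le> n" for Q
  proof -
    have "card {i \<in> {1..n}. Q i} \<le> card {1..n}" by (intro card_mono) auto
    then show ?thesis by simp
  qed
  then show "desync y \<le> n" "deviating \<kappa> y \<le> n" "excess \<kappa> x \<le> n"
    unfolding desync_def deviating_def excess_def by (auto intro: le_trans[OF diff_le_self])
qed

lemma integrable_bounded_nat:
  "(\<And>y. f y \<le> n) \<Longrightarrow> integrable (measure_pmf M) (\<lambda>y. real (f y))"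
  by (intro measure_pmf.integrable_const_bound[where B = n]) auto

text \<open>Only deviating arms can be out of step one period later, and periods are discounted by \<open>\<beta>\<close>.\<close>

lemma expectation_desync:
  "measure_pmf.expectation (coupled \<kappa> p m) (\<lambda>y. real (desync y)) \<le>
    \<beta> * measure_pmf.expectation (coupled \<kappa> p m) (\<lambda>y. real (deviating \<kappa> y))"
proof -
  let ?C = "coupled \<kappa> p m" and ?f = "\<lambda>y. real (desync y)"
  have b: "\<bar>?f y\<bar> \<le> n" for y using desync_le[of y] by simp
  have flow: "?C = mixture \<beta> (coupled_start p m) (bind_pmf ?C (coupled_step \<kappa> p))"
    unfolding coupled_def using discount_pos discount_less by (intro occupation_flow) auto
  have "measure_pmf.expectation ?C ?f =
      (1 - \<beta>) * measure_pmf.expectation (coupled_start p m) ?f +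
      \<beta> * measure_pmf.expectation (bind_pmf ?C (coupled_step \<kappa> p)) ?f"
    using discount_pos discount_less b by (subst flow, intro expectation_mixture[of _ _ _ _ n]) auto
  also have "measure_pmf.expectation (coupled_start p m) ?f =
      measure_pmf.expectation (coupled_start p m) (\<lambda>_. 0)"
    by (intro integral_cong_AE) (auto simp: AE_measure_pmf_iff desync_start)
  also have "measure_pmf.expectation (bind_pmf ?C (coupled_step \<kappa> p)) ?f =
      measure_pmf.expectation ?C (\<lambda>y. measure_pmf.expectation (coupled_step \<kappa> p y) ?f)"
    using b by (intro expectation_bind_pmf)
  also have "\<dots> \<le> measure_pmf.expectation ?C (\<lambda>y. real (deviating \<kappa> y))"
  proof (rule integral_mono)
    have le: "measure_pmf.expectation (coupled_step \<kappa> p y) ?f \<le> real (deviating \<kappa> y)" for y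
    proof -
      have "measure_pmf.expectation (coupled_step \<kappa> p y) ?f \<le>
          measure_pmf.expectation (coupled_step \<kappa> p y) (\<lambda>_. real (deviating \<kappa> y))"
        using desync_step desync_le deviating_le_n
        by (intro integral_mono_AE integrable_bounded_nat) (auto simp: AE_measure_pmf_iff)
      then show ?thesis by simp
    qed
    then show "measure_pmf.expectation (coupled_step \<kappa> p y) ?f \<le> real (deviating \<kappa> y)" for y .
    show "integrable (measure_pmf ?C) (\<lambda>y. measure_pmf.expectation (coupled_step \<kappa> p y) ?f)"
    proof (intro measure_pmf.integrable_const_bound[where B = n])
      have "norm (measure_pmf.expectation (coupled_step \<kappa> p y) ?f) \<le> n" for y
      proof -
        have "measure_pmf.expectation (coupled_step \<kappa> p y) ?f \<le> real n"
          using le[of y] deviating_le_n[of \<kappa> y] by linarith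
        moreover have "0 \<le> measure_pmf.expectation (coupled_step \<kappa> p y) ?f" by simp
        ultimately show ?thesis by simp
      qed
      then show "AE y in ?C. norm (measure_pmf.expectation (coupled_step \<kappa> p y) ?f) \<le> n" by simp
    qed simp
    show "integrable (measure_pmf ?C) (\<lambda>y. real (deviating \<kappa> y))"
      using deviating_le_n by (rule integrable_bounded_nat)
  qed
  finally show ?thesis using discount_pos by (simp add: mult_left_mono)
qed

text \<open>With \<open>D\<close> and \<open>E\<close> the means of \<open>deviating\<close> and
  \<open>excess\<close>, the bounds combine to \<open>D \<le> \<beta> * D + E\<close>, which is
  solved for \<open>D\<close>.\<close>

lemma expectation_deviating:
  "measure_pmf.expectation (coupled \<kappa> p m) (\<lambda>y. real (deviating \<kappa> y)) \<le>
    measure_pmf.expectation (coupled \<kappa> p m) (\<lambda>y. real (excess \<kappa> (shadow_arms y))) / (1 - \<beta>)"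
proof -
  let ?C = "coupled \<kappa> p m"
  have "measure_pmf.expectation ?C (\<lambda>y. real (deviating \<kappa> y)) \<le>
      measure_pmf.expectation ?C (\<lambda>y. real (desync y) + real (excess \<kappa> (shadow_arms y)))"
    using deviating_le desync_le excess_le deviating_le_n
    by (intro integral_mono Bochner_Integration.integrable_add integrable_bounded_nat)
      (auto simp flip: of_nat_add)
  also have "\<dots> = measure_pmf.expectation ?C (\<lambda>y. real (desync y)) +
      measure_pmf.expectation ?C (\<lambda>y. real (excess \<kappa> (shadow_arms y)))"
    using desync_le excess_le
    by (intro Bochner_Integration.integral_add integrable_bounded_nat)
  finally show ?thesis using expectation_desync[of \<kappa> p m] discount_less by (simp add: field_simps)
qed

section \<open>The real and the shadow projections of the coupled system\<close>

text \<open>Given the whole coupled state, the real arms move independently by \<open>P\<close>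
  under the granted actions. Hidden shadows influence only which actions are granted, and the flow
  equation does not ask how actions arise.\<close>

lemma real_snapshot_flow:
  "map_pmf state_of (map_pmf (real_snapshot \<kappa>) (coupled \<kappa> p m)) =
    mixture \<beta> (indep_start S uniform m)
      (bind_pmf (map_pmf (real_snapshot \<kappa>) (coupled \<kappa> p m)) (state_kernel n G P))"
proof -
  let ?C = "coupled \<kappa> p m" and ?d = "(undefined, undefined, undefined) :: 's arm_pair"
  define f :: "'g \<times> (nat \<Rightarrow> 's arm_pair) \<Rightarrow> 'g \<times> (nat \<Rightarrow> 's)"
    where "f = (\<lambda>y. (fst y, \<lambda>i. real_of (snd y i)))"
  have state: "map_pmf state_of (map_pmf (real_snapshot \<kappa>) r) = map_pmf f r" for r
    by (simp add: pmf.map_comp o_def state_of_def real_snapshot_def f_def)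
  have pair: "map_pmf f (map_pmf (Pair g) (Pi_pmf {1..n} ?d q)) =
      map_pmf (Pair g) (Pi_pmf {1..n} undefined (\<lambda>i. map_pmf real_of (q i)))" for g q
    by (subst Pi_pmf_map[of _ _ ?d]) (simp_all add: pmf.map_comp o_def f_def)
  have arm: "map_pmf real_of (couple_arm p g z a) = P g (real_of z) a" for g z a
  proof -
    have "map_pmf real_of (couple_arm p g z a) = bind_pmf (couple g z a) (\<lambda>x. return_pmf (snd x))"
      by (simp add: couple_arm_def map_bind_pmf pmf.map_comp o_def map_pmf_const)
    then show ?thesis by (simp only: map_pmf_def[symmetric] map_snd_couple)
  qed
  have step: "map_pmf f (coupled_step \<kappa> p y) = state_kernel n G P (real_snapshot \<kappa> y)" for y
    unfolding coupled_step_def pair arm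
    by (simp add: state_kernel_def real_snapshot_def G bind_return_pmf map_pmf_def)
  have "map_pmf real_of (map_pmf (\<lambda>(s, b). (s, s, b)) (arm_dist p m g)) = m g" for g
    by (simp add: arm_dist_def map_bind_pmf pmf.map_comp o_def map_pmf_const bind_return_pmf')
  then have start: "map_pmf f (coupled_start p m) = indep_start S uniform m"
    unfolding coupled_start_def map_bind_pmf pair
    by (simp add: indep_start_def narms map_pmf_def)
  have "?C = mixture \<beta> (coupled_start p m) (bind_pmf ?C (coupled_step \<kappa> p))"
    unfolding coupled_def using discount_pos discount_less by (intro occupation_flow) auto
  then have "map_pmf f ?C = map_pmf f (mixture \<beta> (coupled_start p m) (bind_pmf ?C (coupled_step \<kappa> p)))"
    by (rule arg_cong)
  then show ?thesis
    unfolding state by (simp only: map_mixture start map_bind_pmf step bind_map_pmf)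
qed

text \<open>The shadow coordinates move by a kernel of their own, whatever is granted, and the
  product of the stationary arm laws over a uniform context is invariant for it.\<close>

lemma shadow_arms_coupled:
  assumes m: "\<And>g. bind_pmf (m g) (\<lambda>s. bind_pmf (p g s) (P g s)) = m (\<sigma> g)"
  shows "map_pmf shadow_arms (coupled \<kappa> p m) = bind_pmf uniform (\<lambda>g. map_pmf (Pair g)
    (Pi_pmf {1..n} (undefined, undefined) (\<lambda>_. arm_dist p m g)))" (is "_ = ?W")
proof -
  let ?d = "(undefined, undefined, undefined) :: 's arm_pair" and ?d' = "(undefined, undefined) :: 's \<times> bool"
  define move where "move g x = bind_pmf (P g (fst x) (snd x)) (\<lambda>s. map_pmf (Pair s) (p (\<sigma> g) s))"
    for g and x :: "'s \<times> bool"
  define K where "K y = map_pmf (Pair (\<sigma> (fst y))) (Pi_pmf {1..n} ?d' (\<lambda>i. move (fst y) (snd y i)))"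
    for y :: "'g \<times> (nat \<Rightarrow> 's \<times> bool)"
  define sh where "sh z = (shadow_of z, wish_of z)" for z :: "'s arm_pair"
  have pair: "map_pmf shadow_arms (map_pmf (Pair g) (Pi_pmf {1..n} ?d q)) =
      map_pmf (Pair g) (Pi_pmf {1..n} ?d' (\<lambda>i. map_pmf sh (q i)))" for g q
    by (subst Pi_pmf_map[of _ _ ?d]) (simp_all add: pmf.map_comp o_def shadow_arms_def sh_def)
  have arm: "map_pmf sh (couple_arm p g z a) = move g (sh z)" for g z a
  proof -
    have "map_pmf sh (couple_arm p g z a) =
        bind_pmf (map_pmf fst (couple g z a)) (\<lambda>s. map_pmf (Pair s) (p (\<sigma> g) s))"
      by (simp add: couple_arm_def map_bind_pmf pmf.map_comp o_def sh_def bind_map_pmf)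
    then show ?thesis by (simp add: map_fst_couple move_def sh_def)
  qed
  have step: "map_pmf shadow_arms (coupled_step \<kappa> p y) = K (shadow_arms y)" for y
    unfolding coupled_step_def pair arm K_def by (simp add: shadow_arms_def sh_def)
  have "map_pmf sh (map_pmf (\<lambda>(s, b). (s, s, b)) (arm_dist p m g)) = arm_dist p m g" for g
    by (simp add: pmf.map_comp o_def sh_def case_prod_unfold)
  then have start: "map_pmf shadow_arms (coupled_start p m) = ?W"
    unfolding coupled_start_def map_bind_pmf pair by simp
  \<comment> \<open>One arm: moving from the stationary state and action in \<open>g\<close> gives
    \<open>m (\<sigma> g)\<close> by invariance, and the new wish is drawn from \<open>p\<close>
    there.\<close>
  have "bind_pmf (arm_dist p m g) (move g) =
      bind_pmf (bind_pmf (m g) (\<lambda>s. bind_pmf (p g s) (P g s))) (\<lambda>s. map_pmf (Pair s) (p (\<sigma> g) s))" for g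
    by (simp add: arm_dist_def move_def bind_assoc_pmf bind_map_pmf)
  then have move: "bind_pmf (arm_dist p m g) (move g) = arm_dist p m (\<sigma> g)" for g
    by (simp only: m arm_dist_def)
  have "bind_pmf (map_pmf (Pair g) (Pi_pmf {1..n} ?d' (\<lambda>_. arm_dist p m g))) K =
      map_pmf (Pair (\<sigma> g)) (Pi_pmf {1..n} ?d' (\<lambda>_. arm_dist p m (\<sigma> g)))" for g
    unfolding move[symmetric] by (subst Pi_pmf_bind[where d' = ?d']) (simp_all add: K_def bind_map_pmf map_bind_pmf)
  then have "bind_pmf ?W K = bind_pmf (map_pmf \<sigma> uniform)
      (\<lambda>g. map_pmf (Pair g) (Pi_pmf {1..n} ?d' (\<lambda>_. arm_dist p m g)))"
    by (simp add: bind_assoc_pmf bind_map_pmf)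
  then have "bind_pmf ?W K = ?W" by (simp only: map_uniform[OF bij])
  then have "occupation \<beta> ?W K = ?W" by (rule occupation_invariant)
  moreover have "map_pmf shadow_arms (coupled \<kappa> p m) = occupation \<beta> (map_pmf shadow_arms (coupled_start p m)) K"
    unfolding coupled_def by (rule map_occupation) (rule step)
  ultimately show ?thesis by (simp only: start)
qed

text \<open>In each context the wishes are independent Bernoulli trials with mean total at most
  \<open>\<kappa> g + 1\<close>. The summand 1 absorbs rounding a real budget down to an
  integer.\<close>

lemma expectation_excess:
  assumes n: "n \<ge> 1"
    and m: "\<And>g. bind_pmf (m g) (\<lambda>s. bind_pmf (p g s) (P g s)) = m (\<sigma> g)"
    and \<kappa>: "\<And>g. pmf (map_pmf snd (arm_dist p m g)) True * n \<le> real (\<kappa> g) + 1"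
  shows "measure_pmf.expectation (coupled \<kappa> p m) (\<lambda>y. real (excess \<kappa> (shadow_arms y))) \<le> sqrt n + 1"
proof -
  let ?d' = "(undefined, undefined) :: 's \<times> bool"
  let ?X = "\<lambda>g. Pi_pmf {1..n} ?d' (\<lambda>_. arm_dist p m g)"
  have ctx: "measure_pmf.expectation (?X g) (\<lambda>w. real (excess \<kappa> (g, w))) \<le> sqrt n + 1" for g
  proof -
    define q where "q = pmf (map_pmf snd (arm_dist p m g)) True"
    have q: "0 \<le> q" "q \<le> 1" by (auto simp: q_def pmf_nonneg pmf_le_1)
    have bern: "map_pmf snd (arm_dist p m g) = bernoulli_pmf q"
    proof (rule pmf_eqI)
      show "pmf (map_pmf snd (arm_dist p m g)) b = pmf (bernoulli_pmf q) b" for b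
        using q by (cases b) (simp_all add: q_def pmf_False_conv_True)
    qed
    have "map_pmf (\<lambda>w. card {i \<in> {1..n}. snd (w i)}) (?X g) =
        map_pmf (\<lambda>a. card {i \<in> {1..n}. a i}) (map_pmf (\<lambda>w. snd \<circ> w) (?X g))"
      by (simp add: pmf.map_comp o_def)
    also have "map_pmf (\<lambda>w. snd \<circ> w) (?X g) = Pi_pmf {1..n} undefined (\<lambda>_. bernoulli_pmf q)"
      unfolding bern[symmetric] by (rule Pi_pmf_map[symmetric]) simp_all
    also have "map_pmf (\<lambda>a. card {i \<in> {1..n}. a i}) \<dots> = binomial_pmf n q"
      using q by (intro binomial_pmf_altdef'[symmetric]) auto
    finally have binom: "map_pmf (\<lambda>w. card {i \<in> {1..n}. snd (w i)}) (?X g) = binomial_pmf n q" .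
    have int: "integrable (measure_pmf (binomial_pmf n q)) f" for f :: "nat \<Rightarrow> real"
      using q by (intro integrable_measure_pmf_finite) (simp add: set_pmf_binomial_eq)
    have "measure_pmf.expectation (?X g) (\<lambda>w. real (excess \<kappa> (g, w))) =
        measure_pmf.expectation (binomial_pmf n q) (\<lambda>k. real (k - \<kappa> g))"
      unfolding binom[symmetric] by (simp add: excess_def)
    also have "\<dots> \<le> measure_pmf.expectation (binomial_pmf n q) (\<lambda>k. \<bar>real k - q * n\<bar> + 1)"
    proof (intro integral_mono int)
      fix k
      show "real (k - \<kappa> g) \<le> \<bar>real k - q * n\<bar> + 1"
        using \<kappa>[of g] unfolding q_def[symmetric] by linarith
    qed
    also have "\<dots> \<le> sqrt n + 1"
      using int expectation_binomial_deviation[OF q n] by simp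
    finally show ?thesis .
  qed
  have "measure_pmf.expectation (coupled \<kappa> p m) (\<lambda>y. real (excess \<kappa> (shadow_arms y))) =
      measure_pmf.expectation (map_pmf shadow_arms (coupled \<kappa> p m)) (\<lambda>x. real (excess \<kappa> x))"
    by simp
  also have "\<dots> = measure_pmf.expectation uniform (\<lambda>g. measure_pmf.expectation (?X g) (\<lambda>w. real (excess \<kappa> (g, w))))"
    unfolding shadow_arms_coupled[OF m] using excess_le
    by (subst expectation_bind_pmf[of _ _ _ n]) auto
  also have "\<dots> \<le> measure_pmf.expectation uniform (\<lambda>_ :: 'g. sqrt n + 1)"
    by (intro integral_mono ctx integrable_measure_pmf_finite) auto
  finally show ?thesis by simp
qed

text \<open>By linearity only the marginal of a single shadow arm matters, and this is the one-arm
  stationary law.\<close>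

lemma expectation_shadow_reward:
  assumes m: "\<And>g. bind_pmf (m g) (\<lambda>s. bind_pmf (p g s) (P g s)) = m (\<sigma> g)"
  shows "measure_pmf.expectation (coupled \<kappa> p m)
      (\<lambda>y. \<Sum>i = 1..n. R (fst y) (shadow_of (snd y i)) (wish_of (snd y i))) =
    n * measure_pmf.expectation (bind_pmf uniform (\<lambda>g. map_pmf (Pair g) (arm_dist p m g)))
      (\<lambda>x. R (fst x) (fst (snd x)) (snd (snd x)))"
proof -
  let ?W = "bind_pmf uniform (\<lambda>g. map_pmf (Pair g) (arm_dist p m g))"
  obtain B where B: "\<And>g s a. \<bar>R g s a\<bar> \<le> B" using finite_arm_bounded[of R] by blast
  have arm: "measure_pmf.expectation (coupled \<kappa> p m) (\<lambda>y. R (fst y) (shadow_of (snd y i)) (wish_of (snd y i))) =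
      measure_pmf.expectation ?W (\<lambda>x. R (fst x) (fst (snd x)) (snd (snd x)))" if i: "i \<in> {1..n}" for i
  proof -
    have "map_pmf (\<lambda>y. (fst y, snd y i)) (map_pmf shadow_arms (coupled \<kappa> p m)) =
        bind_pmf uniform (\<lambda>g. map_pmf (Pair g) (map_pmf (\<lambda>w. w i)
          (Pi_pmf {1..n} (undefined, undefined) (\<lambda>_. arm_dist p m g))))"
      unfolding shadow_arms_coupled[OF m] by (simp add: map_bind_pmf pmf.map_comp o_def)
    also have "\<dots> = ?W" using i by (subst Pi_pmf_component) auto
    finally have "measure_pmf.expectation ?W (\<lambda>x. R (fst x) (fst (snd x)) (snd (snd x))) =
        measure_pmf.expectation (map_pmf (\<lambda>y. (fst y, snd y i)) (map_pmf shadow_arms (coupled \<kappa> p m)))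
          (\<lambda>x. R (fst x) (fst (snd x)) (snd (snd x)))"
      by (rule arg_cong[OF sym])
    also have "\<dots> = measure_pmf.expectation (coupled \<kappa> p m)
        (\<lambda>y. R (fst y) (shadow_of (snd y i)) (wish_of (snd y i)))"
      by (simp add: shadow_arms_def)
    finally show ?thesis by (rule sym)
  qed
  have "measure_pmf.expectation (coupled \<kappa> p m)
      (\<lambda>y. \<Sum>i = 1..n. R (fst y) (shadow_of (snd y i)) (wish_of (snd y i))) =
    (\<Sum>i = 1..n. measure_pmf.expectation (coupled \<kappa> p m) (\<lambda>y. R (fst y) (shadow_of (snd y i)) (wish_of (snd y i))))"
    using B by (intro Bochner_Integration.integral_sum measure_pmf.integrable_const_bound[where B = B]) auto
  also have "\<dots> = (\<Sum>i = 1..n. measure_pmf.expectation ?W (\<lambda>x. R (fst x) (fst (snd x)) (snd (snd x))))"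
    by (rule sum.cong[OF refl arm])
  finally show ?thesis by simp
qed

lemma primal_policy:
  assumes n: "n \<ge> 1"
    and m: "\<And>g. bind_pmf (m g) (\<lambda>s. bind_pmf (p g s) (P g s)) = m (\<sigma> g)"
    and \<kappa>: "\<And>g. pmf (map_pmf snd (arm_dist p m g)) True * n \<le> real (\<kappa> g) + 1"
    and budget: "\<And>g. real (\<kappa> g) \<le> budget S g"
    and B: "\<And>g s a. \<bar>R g s a\<bar> \<le> B"
  obtains \<pi> where "\<pi> \<in> primal_feasible S (indep_start S uniform m)"
    "objective S (indep_start S uniform m) \<pi> \<ge>
      (n * measure_pmf.expectation (bind_pmf uniform (\<lambda>g. map_pmf (Pair g) (arm_dist p m g)))
        (\<lambda>x. R (fst x) (fst (snd x)) (snd (snd x))) - 2 * B * ((sqrt n + 1) / (1 - \<beta>))) / (1 - \<beta>)"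
proof -
  let ?C = "coupled \<kappa> p m" and ?\<iota> = "indep_start S uniform m"
  let ?M = "map_pmf (real_snapshot \<kappa>) ?C"
  let ?W = "bind_pmf uniform (\<lambda>g. map_pmf (Pair g) (arm_dist p m g))"
  let ?real = "\<lambda>y. \<Sum>i = 1..n. R (fst y) (real_of (snd y i)) (granted \<kappa> y i)"
  let ?shadow = "\<lambda>y. \<Sum>i = 1..n. R (fst y) (shadow_of (snd y i)) (wish_of (snd y i))"
  have B0: "0 \<le> B" using B[of undefined undefined undefined] by linarith
  have "actions_of x \<in> {1..n} \<rightarrow>\<^sub>E UNIV" if "x \<in> set_pmf ?M" for x
    using that by (auto simp: real_snapshot_def granted_def)
  with real_snapshot_flow obtain \<pi> where \<pi>: "\<pi> \<in> policies S" "crb_occupation S ?\<iota> \<pi> = ?M"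
    by (rule flow_policy)
  have "(\<Sum>i = 1..n. of_bool (actions_of x i)) \<le> budget S (ctx_of x)" if x: "x \<in> set_pmf ?M" for x
  proof -
    obtain y where y: "x = real_snapshot \<kappa> y" using x by auto
    have "(\<Sum>i = 1..n. of_bool (granted \<kappa> y i)) = real (card {i \<in> {1..n}. granted \<kappa> y i})"
      by (simp add: Int_def)
    also have "\<dots> \<le> real (\<kappa> (fst y))" using card_granted by simp
    also have "\<dots> \<le> budget S (fst y)" by (rule budget)
    finally show ?thesis by (simp add: y real_snapshot_def)
  qed
  then have feasible: "\<pi> \<in> primal_feasible S ?\<iota>"
    unfolding primal_feasible_iff \<pi>(2) using \<pi>(1) by blast
  \<comment> \<open>Rewards lie between \<open>- B\<close> and \<open>B\<close>, so a deviating arm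
    loses at most \<open>2 * B\<close> and every other arm nothing.\<close>
  have loss: "?shadow y - ?real y \<le> 2 * B * real (deviating \<kappa> y)" for y
  proof -
    let ?dev = "\<lambda>i. shadow_of (snd y i) \<noteq> real_of (snd y i) \<or> wish_of (snd y i) \<noteq> granted \<kappa> y i"
    have "R (fst y) (shadow_of (snd y i)) (wish_of (snd y i)) - R (fst y) (real_of (snd y i)) (granted \<kappa> y i)
        \<le> (if ?dev i then 2 * B else 0)" for i
      using B[of "fst y" "shadow_of (snd y i)" "wish_of (snd y i)"]
        B[of "fst y" "real_of (snd y i)" "granted \<kappa> y i"] by (auto simp: abs_le_iff)
    then have "?shadow y - ?real y \<le> (\<Sum>i = 1..n. if ?dev i then 2 * B else 0)"
      unfolding sum_subtractf[symmetric] by (rule sum_mono)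
    also have "\<dots> = (\<Sum>i\<in>{i \<in> {1..n}. ?dev i}. 2 * B)"
      by (rule sum.inter_filter[symmetric]) (rule finite_atLeastAtMost)
    also have "\<dots> = 2 * B * real (deviating \<kappa> y)"
      unfolding deviating_def sum_constant by (rule mult.commute)
    finally show ?thesis .
  qed
  have int: "integrable (measure_pmf ?C) (\<lambda>y. \<Sum>i = 1..n. R (fst y) (u y i) (v y i))" for u v
    using B by (intro Bochner_Integration.integrable_sum measure_pmf.integrable_const_bound[where B = B]) auto
  have int_dev: "integrable (measure_pmf ?C) (\<lambda>y. real (deviating \<kappa> y))"
    using deviating_le_n by (rule integrable_bounded_nat)
  have "measure_pmf.expectation ?C ?shadow - 2 * B * measure_pmf.expectation ?C (\<lambda>y. real (deviating \<kappa> y)) =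
      measure_pmf.expectation ?C (\<lambda>y. ?shadow y - 2 * B * real (deviating \<kappa> y))"
    using int int_dev by simp
  also have "\<dots> \<le> measure_pmf.expectation ?C ?real"
  proof (rule integral_mono)
    show "integrable (measure_pmf ?C) (\<lambda>y. ?shadow y - 2 * B * real (deviating \<kappa> y))"
      using int int_dev by simp
    show "?shadow y - 2 * B * real (deviating \<kappa> y) \<le> ?real y" for y
      using loss[of y] by linarith
  qed (rule int)
  finally have 1: "measure_pmf.expectation ?C ?shadow -
      2 * B * measure_pmf.expectation ?C (\<lambda>y. real (deviating \<kappa> y)) \<le> measure_pmf.expectation ?C ?real" .
  have "measure_pmf.expectation ?C (\<lambda>y. real (deviating \<kappa> y)) \<le> (sqrt n + 1) / (1 - \<beta>)"
    using expectation_excess[OF n m \<kappa>] discount_less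
    by (intro order_trans[OF expectation_deviating] divide_right_mono) auto
  then have 2: "2 * B * measure_pmf.expectation ?C (\<lambda>y. real (deviating \<kappa> y)) \<le> 2 * B * ((sqrt n + 1) / (1 - \<beta>))"
    using B0 by (intro mult_left_mono) auto
  have "objective S ?\<iota> \<pi> = measure_pmf.expectation ?C ?real / (1 - \<beta>)"
    unfolding objective_occupation \<pi>(2) by (simp add: real_snapshot_def)
  moreover have "n * measure_pmf.expectation ?W (\<lambda>x. R (fst x) (fst (snd x)) (snd (snd x))) -
      2 * B * ((sqrt n + 1) / (1 - \<beta>)) \<le> measure_pmf.expectation ?C ?real"
    using 1 2 unfolding expectation_shadow_reward[OF m] by linarith
  ultimately show thesis
    using feasible discount_less by (intro that[of \<pi>]) (auto intro: divide_right_mono)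
qed

end

section \<open>The square-root gap\<close>

theorem theorem1:
  fixes sys :: "nat \<Rightarrow> ('g::finite, 's::finite) crb"
    and G :: "'g \<Rightarrow> 'g pmf"
    and P :: "'g \<Rightarrow> 's \<Rightarrow> bool \<Rightarrow> 's pmf"
    and R :: "'g \<Rightarrow> 's \<Rightarrow> bool \<Rightarrow> real"
    and \<beta> :: real
    and \<alpha> :: "'g \<Rightarrow> real"
    and T :: nat
  assumes narms: "\<And>N. N \<ge> 1 \<Longrightarrow> narms (sys N) = N"
    and ctx: "\<And>N. N \<ge> 1 \<Longrightarrow> ctx_kernel (sys N) = G"
    and discount: "\<And>N. N \<ge> 1 \<Longrightarrow> discount (sys N) = \<beta>"
    and "0 < \<beta>" and "\<beta> < 1"
    and recurrent: "positive_recurrent G"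
    and A1: "\<And>N i. N \<ge> 1 \<Longrightarrow> i \<in> {1..N} \<Longrightarrow> arm_kernel (sys N) i = P \<and> reward (sys N) i = R"
    and A2: "\<And>g s a s'. pmf (P g s a) s' \<in> \<rat>"
    and A3: "T \<ge> 1" "AE \<omega> in chain (pmf_of_set UNIV) G. \<forall>t. \<omega> (t + T) = \<omega> t"
    and A4: "\<And>N g. N \<ge> 1 \<Longrightarrow> budget (sys N) g = \<alpha> g * real N"
  shows "\<exists>f \<in> O(\<lambda>N. sqrt (real N)).
    \<forall>(\<pi> :: ('g, 's) policy) (m :: 'g \<Rightarrow> 's pmf) (\<gamma> :: 'g pmf) (\<mu> :: 'g \<Rightarrow> 's pmf).
      let \<iota> = (\<lambda>N. indep_start (sys N) (pmf_of_set UNIV) m)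
      in relaxed_optimal (sys 1) (\<iota> 1) \<pi> \<longrightarrow>
         steady_state (sys 1) (indep_start (sys 1) \<gamma> \<mu>) \<pi> m \<longrightarrow>
         (\<forall>N\<ge>1. relaxed_value (sys N) (\<iota> N) \<ge> primal_value (sys N) (\<iota> N) \<and>
           primal_value (sys N) (\<iota> N) \<ge> relaxed_value (sys N) (\<iota> N) - f N)"
proof -
  obtain \<sigma> where \<sigma>: "bij \<sigma>" "\<And>g. G g = return_pmf (\<sigma> g)"
    using periodic_chain_permutation[OF A3] by blast
  obtain B where B: "\<And>g s a. \<bar>R g s a\<bar> \<le> B" using finite_arm_bounded[of R] by blast
  have B0: "0 \<le> B" using B[of undefined undefined undefined] by linarith
  have system: "permuted_contexts (sys N) N G P R \<beta> \<sigma>" if "N \<ge> 1" for N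
    using that narms ctx discount A1 \<sigma> \<open>0 < \<beta>\<close> \<open>\<beta> < 1\<close> by unfold_locales auto
  \<comment> \<open>The factors are \<open>2 * B\<close> per deviating arm,
    \<open>sqrt N + 1 \<le> 2 * sqrt N\<close> for the excess, one \<open>1 / (1 - \<beta>)\<close>
    for the accumulation of arms out of step and another for undoing the normalisation. None depends
    on \<open>\<pi>\<close>, \<open>m\<close>, \<open>\<gamma>\<close> or
    \<open>\<mu>\<close>.\<close>
  define f where "f N = 4 * B / (1 - \<beta>)\<^sup>2 * sqrt (real N)" for N
  have bound: "primal_value (sys N) (indep_start (sys N) uniform m) \<le>
        relaxed_value (sys N) (indep_start (sys N) uniform m) \<and>
      relaxed_value (sys N) (indep_start (sys N) uniform m) - f N \<le>
        primal_value (sys N) (indep_start (sys N) uniform m)"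
    if opt: "relaxed_optimal (sys 1) (indep_start (sys 1) uniform m) \<pi>"
      and steady: "steady_state (sys 1) (indep_start (sys 1) \<gamma> \<mu>) \<pi> m"
      and N: "N \<ge> 1"
    for \<pi> :: "('g, 's) policy" and m \<gamma> \<mu> and N :: nat
  proof -
    interpret one: permuted_contexts "sys 1" 1 G P R \<beta> \<sigma> by (rule system) simp
    interpret many: permuted_contexts "sys N" N G P R \<beta> \<sigma> by (rule system[OF N])
    let ?\<iota>1 = "indep_start (sys 1) uniform m" and ?\<iota> = "indep_start (sys N) uniform m"
    let ?p = "arm_policy \<pi>"
    let ?W = "bind_pmf uniform (\<lambda>g. map_pmf (Pair g) (arm_dist ?p m g))"
    define v where "v = objective (sys 1) ?\<iota>1 \<pi>"
    have m: "bind_pmf (m g) (\<lambda>s. bind_pmf (?p g s) (P g s)) = m (\<sigma> g)" for g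
      using one.steady_state_invariant[OF refl steady] .
    have W: "map_pmf (\<lambda>y. (ctx_of y, states_of y 1, actions_of y 1)) (crb_occupation (sys 1) ?\<iota>1 \<pi>) = ?W"
      by (rule one.occupation_invariant_arm[OF refl m])
    have expectation_W: "measure_pmf.expectation (crb_occupation (sys 1) ?\<iota>1 \<pi>)
        (\<lambda>y. h (ctx_of y) (states_of y 1) (actions_of y 1)) =
      measure_pmf.expectation ?W (\<lambda>x. h (fst x) (fst (snd x)) (snd (snd x)))" for h :: "'g \<Rightarrow> 's \<Rightarrow> bool \<Rightarrow> real"
      unfolding W[symmetric] by simp
    have v: "(1 - \<beta>) * v = measure_pmf.expectation ?W (\<lambda>x. R (fst x) (fst (snd x)) (snd (snd x)))"
      using \<open>\<beta> < 1\<close> unfolding v_def one.objective_occupation by (simp add: expectation_W[simplified])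
    have feasible: "\<pi> \<in> relaxed_feasible (sys 1) ?\<iota>1"
      and best: "\<And>\<pi>'. \<pi>' \<in> relaxed_feasible (sys 1) ?\<iota>1 \<Longrightarrow> objective (sys 1) ?\<iota>1 \<pi>' \<le> v"
      using opt by (auto simp: relaxed_optimal_def v_def)
    \<comment> \<open>Under the stationary law each context has weight \<open>1 / card UNIV\<close>,
      which cancels from both sides of the relaxed constraint.\<close>
    have active: "pmf (map_pmf snd (arm_dist ?p m g)) True \<le> \<alpha> g" for g
    proof -
      have W_exp: "measure_pmf.expectation ?W (\<lambda>x. of_bool (fst x = g) * h (snd x)) =
          measure_pmf.expectation (arm_dist ?p m g) h / card (UNIV :: 'g set)"
        if "\<And>x. \<bar>h x\<bar> \<le> 1" for h :: "'s \<times> bool \<Rightarrow> real"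
      proof -
        have "measure_pmf.expectation ?W (\<lambda>x. of_bool (fst x = g) * h (snd x)) =
            measure_pmf.expectation uniform
              (\<lambda>g'. of_bool (g' = g) * measure_pmf.expectation (arm_dist ?p m g') h)"
          using that by (subst expectation_bind_pmf[of _ _ _ 1]) (auto simp: abs_mult)
        also have "\<dots> = (\<Sum>g'\<in>UNIV. of_bool (g' = g) * measure_pmf.expectation (arm_dist ?p m g') h) /
            card (UNIV :: 'g set)"
          by (subst integral_pmf_of_set) auto
        also have "(\<Sum>g'\<in>UNIV. of_bool (g' = g) * measure_pmf.expectation (arm_dist ?p m g') h) =
            (\<Sum>g'\<in>UNIV. if g = g' then measure_pmf.expectation (arm_dist ?p m g') h else 0)"
          by (intro sum.cong) auto
        finally show ?thesis by simp
      qed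
      have single: "(\<Sum>i = 1..1. of_bool (a i)) = (of_bool (a 1) :: real)" for a :: "nat \<Rightarrow> bool"
        by simp
      have "measure_pmf.expectation ?W (\<lambda>x. of_bool (fst x = g) * of_bool (snd (snd x))) \<le>
          measure_pmf.expectation ?W (\<lambda>x. of_bool (fst x = g)) * \<alpha> g"
      proof -
        have "measure_pmf.expectation (crb_occupation (sys 1) ?\<iota>1 \<pi>)
            (\<lambda>y. of_bool (ctx_of y = g) * of_bool (actions_of y 1)) \<le>
          measure_pmf.expectation (crb_occupation (sys 1) ?\<iota>1 \<pi>) (\<lambda>y. of_bool (ctx_of y = g)) *
            budget (sys 1) g"
          using feasible unfolding one.relaxed_feasible_iff single by blast
        then show ?thesis
          unfolding expectation_W[of "\<lambda>h _ a. of_bool (h = g) * of_bool a"]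
            expectation_W[of "\<lambda>h _ _. of_bool (h = g)"]
          by (simp add: A4)
      qed
      moreover have "measure_pmf.expectation (arm_dist ?p m g) (\<lambda>x. of_bool (snd x)) =
          pmf (map_pmf snd (arm_dist ?p m g)) True"
      proof -
        have "(\<lambda>x. of_bool (snd x)) = (indicator {x. snd x} :: 's \<times> bool \<Rightarrow> real)"
          by (auto simp: indicator_def)
        then show ?thesis by (simp add: pmf_map vimage_def)
      qed
      ultimately show ?thesis
        using W_exp[of "\<lambda>x. of_bool (snd x)"] W_exp[of "\<lambda>_. 1"] by (simp add: divide_le_cancel)
    qed
    define \<kappa> where "\<kappa> g = nat \<lfloor>\<alpha> g * real N\<rfloor>" for g
    \<comment> \<open>\<open>\<alpha> g\<close> dominates a probability, hence is nonnegative, and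
      \<open>nat\<close> does not distort the floor.\<close>
    have \<alpha>: "0 \<le> \<alpha> g * real N" for g
      by (intro mult_nonneg_nonneg order_trans[OF pmf_nonneg active]) auto
    have \<kappa>: "pmf (map_pmf snd (arm_dist ?p m g)) True * real N \<le> real (\<kappa> g) + 1" for g
    proof -
      have "pmf (map_pmf snd (arm_dist ?p m g)) True * real N \<le> \<alpha> g * real N"
        using active by (intro mult_right_mono) auto
      also have "\<dots> \<le> real (\<kappa> g) + 1" using \<alpha>[of g] unfolding \<kappa>_def by linarith
      finally show ?thesis .
    qed
    have budget: "real (\<kappa> g) \<le> budget (sys N) g" for g
      using \<alpha>[of g] by (simp add: A4[OF N] \<kappa>_def)
    obtain \<pi>N where \<pi>N: "\<pi>N \<in> primal_feasible (sys N) ?\<iota>"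
      and \<pi>N_val: "objective (sys N) ?\<iota> \<pi>N \<ge>
        (N * ((1 - \<beta>) * v) - 2 * B * ((sqrt N + 1) / (1 - \<beta>))) / (1 - \<beta>)"
      using many.primal_policy[OF N m \<kappa> budget B] unfolding v by blast
    have gap: "N * v - f N \<le> objective (sys N) ?\<iota> \<pi>N"
    proof -
      have "2 * B * ((sqrt N + 1) / (1 - \<beta>)) \<le> 2 * B * (2 * sqrt N / (1 - \<beta>))"
        using B0 N \<open>\<beta> < 1\<close> by (intro mult_left_mono divide_right_mono) auto
      then have "(N * ((1 - \<beta>) * v) - 2 * B * (2 * sqrt N / (1 - \<beta>))) / (1 - \<beta>) \<le> objective (sys N) ?\<iota> \<pi>N"
        using \<open>\<beta> < 1\<close> by (intro order_trans[OF _ \<pi>N_val] divide_right_mono) auto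
      moreover have "(N * ((1 - \<beta>) * v) - 2 * B * (2 * sqrt N / (1 - \<beta>))) / (1 - \<beta>) = N * v - f N"
        using \<open>\<beta> < 1\<close> by (simp add: f_def power2_eq_square diff_divide_distrib)
      ultimately show ?thesis by simp
    qed
    have upper: "objective (sys N) ?\<iota> \<pi>' \<le> N * v" if \<pi>': "\<pi>' \<in> relaxed_feasible (sys N) ?\<iota>" for \<pi>'
    proof -
      have "budget (sys N) g = budget (sys 1) g * N" for g using A4[of 1 g] A4[OF N, of g] by simp
      from relaxed_average_arm[OF N one.identical_arms_axioms many.identical_arms_axioms this \<pi>']
      show ?thesis using best by (metis mult_left_mono of_nat_0_le_iff)
    qed
    have sub: "primal_feasible (sys N) ?\<iota> \<subseteq> relaxed_feasible (sys N) ?\<iota>"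
      by (rule many.primal_subset_relaxed)
    \<comment> \<open>A supremum of reals is meaningful only for a bounded nonempty set:
      \<open>upper\<close> bounds the relaxed values and so the primal ones, and
      \<open>\<pi>N\<close> shows that both sets are nonempty.\<close>
    have bdd: "bdd_above (objective (sys N) ?\<iota> ` relaxed_feasible (sys N) ?\<iota>)"
      using upper by (intro bdd_aboveI[of _ "N * v"]) auto
    have "primal_value (sys N) ?\<iota> \<le> relaxed_value (sys N) ?\<iota>"
      unfolding primal_value_def relaxed_value_def using \<pi>N sub bdd by (intro cSUP_subset_mono) auto
    moreover have "relaxed_value (sys N) ?\<iota> \<le> N * v"
      unfolding relaxed_value_def using \<pi>N sub upper by (intro cSUP_least) auto
    moreover have "objective (sys N) ?\<iota> \<pi>N \<le> primal_value (sys N) ?\<iota>"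
      unfolding primal_value_def using \<pi>N bdd_above_mono[OF bdd image_mono[OF sub]]
      by (intro cSUP_upper)
    ultimately show ?thesis using gap by linarith
  qed
  have "f \<in> O(\<lambda>N. sqrt (real N))"
    unfolding f_def by (intro bigoI[of _ "\<bar>4 * B / (1 - \<beta>)\<^sup>2\<bar>"] always_eventually) (simp add: abs_mult)
  then show ?thesis using bound unfolding Let_def by blast
qed

end
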